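(* Let $n\ge 1$, let $N$ and $V$ be finite disjoint sets with $|N|=|V|=n$, and let $Q\subseteq\mathbb{R}^{n^3}$ be the polyhedron of achievable probabilities. Let $h\in\{2,\dots,n-1\}$, $r\in[n-1]$, $t\in[n-h]$ and $q\in\{0,\dots,h-2\}$. For every $J\subseteq V$ with $|J|=h$, every $I\subseteq N$ with $|I|=r$, and every $i_t,i_{t+1},\dots,i_{t+h-q-2}\in N$ (repetitions allowed), the inequality $$r\sum_{\tau=t+h-q}^{n}Z_{N,J}^{\tau}+n\,Z_{I,J}^{t+h-q-1}+\sum_{\tau=t}^{t+h-q-2}n^{t+h-q-\tau}Z_{i_\tau,J}^{\tau}\le r(q+1)+\sum_{\tau=1}^{h-q-1}n^{h-q-\tau}$$ is facet-defining for $Q$.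
   Context: $[n]=\{1,\dots,n\}$; singletons are identified with their element. For $I\subseteq N$, $J\subseteq V$, $t\in[n]$: $Z_{I,J}^t:=\sum_{i\in I}\sum_{j\in J}z_{ij}^t$. Online bipartite matching model: $N$ is the set of impression types, $V$ the set of ads, $|N|=|V|=n$, and there are $n$ stages, counted down $t=n,n-1,\dots,1$ (stage $n$ is first; $t$ is the number of remaining decision epochs including the current one). At each stage an impression type is drawn independently and uniformly from $N$ and must be immediately and irrevocably matched to a still-available ad of $V$ or discarded; each ad is matched at most once. All pairs in $N\times V$ may be matched. Polyhedron of achievable probabilities $Q$. Consider nonnegative variables $x_{i,j}^{t,S}$ for $t\in[n]$, $i\in N$, $j\in V$, $S\subseteq V\setminus j$ with $|S|\ge t-1$ (probability that in stage $t$ type $i$ appears, the available ads are $S\cup j$, and $i$ is matched to $j$), and $y_i^{t,S}$ for $t\in[n]$, $i\in N$, $S\subseteq V$ with $|S|\ge t$ (probability that in stage $t$ type $i$ appears, the available ads are $S$, and $i$ is discarded), subject to (a) $\sum_{j\in V}x_{i,j}^{n,V\setminus j}+y_i^{n,V}\le \frac1n$ for $i\in N$; (b) $\sum_{j\in S}x_{i,j}^{t,S\setminus j}+y_i^{t,S}1_{\{t\ne1\}}-\frac1n 1_{\{|S|>t\}}\sum_{k\in N}y_k^{t+1,S}-\frac1n\sum_{k\in N}\sum_{j\in V\setminus S}x_{k,j}^{t+1,S}\le 0$ for $t\in[n-1]$, $i\in N$, $\emptyset\ne S\subsetneq V$ with $|S|\ge t$; (c) $\sum_{j\in V}x_{i,j}^{t,V\setminus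 j}+y_i^{t,V}1_{\{t\ne1\}}-\frac1n\sum_{k\in N}y_k^{t+1,V}\le0$ for $t\in[n-1]$, $i\in N$. Here $1_{\mathcal A}$ is $1$ if condition $\mathcal A$ holds and $0$ otherwise. $Q$ is the set of $z=(z_{ij}^t)_{i\in N,j\in V,t\in[n]}\in\mathbb{R}^{n^3}$ for which there is a feasible $(x,y)\ge0$ with $z_{ij}^t=\sum_{S}x_{i,j}^{t,S}$ (sum over $S\subseteq V\setminus j$ with $|S|\ge t-1$). Thus $z_{ij}^t$ is the probability that impression type $i$ is matched to ad $j$ in stage $t$ under some feasible policy. $Q$ is full-dimensional in $\mathbb{R}^{n^3}$. An inequality is facet-defining for $Q$ if it is valid for $Q$ and the set of points of $Q$ satisfying it with equality has dimension $n^3-1$. *)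

theory Defs
  imports "HOL-Analysis.Analysis"
begin

text \<open>
  The impression types \<open>N\<close> and the ads \<open>V\<close> are the universes of two finite types \<open>'i\<close> and \<open>'v\<close>
  of equal cardinality \<open>n\<close>, where \<open>n\<close> is read off as \<open>CARD('i)\<close>.  Stages form a copy of
  \<open>{1..n}\<close>, so that points \<open>z\<close> live in the Euclidean space \<open>real ^ ('i \<times> 'v \<times> 'i stage)\<close>
  of dimension \<open>n ^ 3\<close>.
\<close>

typedef (overloaded) ('i::finite) stage = "{1..CARD('i)}"
  morphisms stage_no Stage
  by (rule exI[of _ 1]) (simp add: Suc_le_eq)

lemma UNIV_stage: "(UNIV :: 'i::finite stage set) = Stage ` {1..CARD('i)}"
  by (metis type_definition.Abs_image type_definition_stage)

instance stage :: (finite) finite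
  by standard (simp add: UNIV_stage)

lemma card_stage: "CARD('i::finite stage) = CARD('i)"
  using type_definition.card[OF type_definition_stage] by (metis card_atLeastAtMost diff_Suc_1)

lemma DIM_points:
  assumes "CARD('v::finite) = CARD('i::finite)"
  shows "DIM(real ^ ('i \<times> 'v \<times> 'i stage)) = CARD('i) ^ 3"
  by (simp add: card_stage assms power3_eq_cube)

text \<open>
  \<open>x t i j S\<close> is the probability that in stage \<open>t\<close> type \<open>i\<close> appears, the available ads are
  \<open>S \<union> {j}\<close>, and \<open>i\<close> is matched to \<open>j\<close>; \<open>y t i S\<close> is the probability that in stage \<open>t\<close>
  type \<open>i\<close> appears, the available ads are \<open>S\<close>, and \<open>i\<close> is discarded.  The values of \<open>x\<close>
  and \<open>y\<close> outside the index ranges of the nonnegativity constraints are irrelevant: they occur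
  neither in the other constraints nor in the projection below.
\<close>

definition feasible ::
  "(nat \<Rightarrow> 'i::finite \<Rightarrow> 'v::finite \<Rightarrow> 'v set \<Rightarrow> real) \<Rightarrow> (nat \<Rightarrow> 'i \<Rightarrow> 'v set \<Rightarrow> real) \<Rightarrow> bool"
where
  "feasible x y \<longleftrightarrow>
     (let n = CARD('i) in
       (\<forall>t\<in>{1..n}. \<forall>i j S. S \<subseteq> UNIV - {j} \<and> card S \<ge> t - 1 \<longrightarrow> x t i j S \<ge> 0) \<and>
       (\<forall>t\<in>{1..n}. \<forall>i S. card S \<ge> t \<longrightarrow> y t i S \<ge> 0) \<and>
       (\<forall>i. (\<Sum>j\<in>UNIV. x n i j (UNIV - {j})) + y n i UNIV \<le> 1 / real n) \<and>
       (\<forall>t\<in>{1..n-1}. \<forall>i S. S \<noteq> {} \<and> S \<subset> UNIV \<and> card S \<ge> t \<longrightarrow>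
          (\<Sum>j\<in>S. x t i j (S - {j})) + y t i S * of_bool (t \<noteq> 1)
          - 1 / real n * of_bool (card S > t) * (\<Sum>k\<in>UNIV. y (t + 1) k S)
          - 1 / real n * (\<Sum>k\<in>UNIV. \<Sum>j\<in>UNIV - S. x (t + 1) k j S) \<le> 0) \<and>
       (\<forall>t\<in>{1..n-1}. \<forall>i.
          (\<Sum>j\<in>UNIV. x t i j (UNIV - {j})) + y t i UNIV * of_bool (t \<noteq> 1)
          - 1 / real n * (\<Sum>k\<in>UNIV. y (t + 1) k UNIV) \<le> 0))"

definition achievable :: "(real ^ ('i::finite \<times> 'v::finite \<times> 'i stage)) set" where
  "achievable =
     {z. \<exists>x y. feasible x y \<and>
        (\<forall>i j \<tau>. z $ (i, j, \<tau>) =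
           (\<Sum>S | S \<subseteq> UNIV - {j} \<and> card S \<ge> stage_no \<tau> - 1. x (stage_no \<tau>) i j S))}"

text \<open>Only meaningful for \<open>\<tau> \<in> {1..CARD('i)}\<close>, where \<open>Stage\<close> is the inverse of \<open>stage_no\<close>.\<close>

definition Zsum ::
  "(real ^ ('i::finite \<times> 'v::finite \<times> 'i stage)) \<Rightarrow> 'i set \<Rightarrow> 'v set \<Rightarrow> nat \<Rightarrow> real" where
  "Zsum z I J \<tau> = (\<Sum>i\<in>I. \<Sum>j\<in>J. z $ (i, j, Stage \<tau>))"

text \<open>
  Facets for the full-dimensional polyhedron of achievable probabilities: by \<open>DIM_points\<close>, the
  ambient space has dimension \<open>CARD('i) ^ 3\<close>.
\<close>

definition facet_defining ::
  "(real ^ ('i::finite \<times> 'v::finite \<times> 'i stage)) set \<Rightarrow>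
   (real ^ ('i \<times> 'v \<times> 'i stage) \<Rightarrow> real) \<Rightarrow> real \<Rightarrow> bool" where
  "facet_defining Q f b \<longleftrightarrow>
     (\<forall>z\<in>Q. f z \<le> b) \<and> aff_dim {z\<in>Q. f z = b} = int (CARD('i) ^ 3) - 1"

end

theory Submission
  imports Defs
begin

text \<open>
  The maximum of a linear functional over the polyhedron is the value of a finite-horizon dynamic
  program: the balance constraints telescope against its value function, and every deterministic
  policy yields a point of the polyhedron.  A policy attains the maximum if it uses only moves that
  are optimal in the dynamic program.  A linear functional that is constant on the resulting face
  therefore gives equal value to all optimal moves in each state reachable by optimal moves.

  For the given inequality put \<open>m = h - q - 1\<close>.  Matching an ad of \<open>J\<close> in stage \<open>t + s\<close> gains \<open>g(s)\<close> for
  the active types, where \<open>g(s) = n ^ (m + 1 - s)\<close> for \<open>s \<le> m\<close> and \<open>g(s) = r\<close> beyond, and the active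
  types are just so many that the mean gain is \<open>g(s + 1)\<close>.  Since \<open>g\<close> is nonincreasing, \<open>k\<close> remaining
  ads of \<open>J\<close> are worth \<open>g(1) + \<dots> + g(min k (s + 1))\<close> before stage \<open>t + s\<close>: an active type should be
  matched iff \<open>k > s\<close>, with a tie for \<open>k \<le> s\<close> and \<open>g(k) = g(s)\<close>, and an inactive type may be matched
  iff \<open>k > s\<close>.  States in which every ad outside \<open>J\<close> is still available show enough ties to determine,
  stage by stage from the last one, all coefficients up to a common factor.
\<close>

section \<open>Summation over states before and after a match\<close>

lemma sum_remove_reindex:
  fixes f :: "'v::finite \<Rightarrow> 'v set \<Rightarrow> 'b::comm_monoid_add"
  shows "(\<Sum>S\<in>UNIV. \<Sum>j\<in>-S. f j S) = (\<Sum>S\<in>UNIV. \<Sum>j\<in>S. f j (S - {j}))"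
proof -
  have "(\<Sum>S\<in>UNIV. \<Sum>j\<in>-S. f j S) = (\<Sum>(S, j)\<in>Sigma UNIV (\<lambda>S. -S). f j S)"
    by (subst sum.Sigma) auto
  also have "\<dots> = (\<Sum>(S, j)\<in>Sigma UNIV (\<lambda>S. S). f j (S - {j}))"
    by (rule sum.reindex_bij_witness[where j = "\<lambda>(S, j). (insert j S, j)" and i = "\<lambda>(S, j). (S - {j}, j)"])
      auto
  also have "\<dots> = (\<Sum>S\<in>UNIV. \<Sum>j\<in>S. f j (S - {j}))"
    by (subst sum.Sigma) auto
  finally show ?thesis .
qed

text \<open>The set index of \<open>x\<close> is what is left after a match, whereas balance
  constraints and value functions speak of the state before it. Pairing \<open>S\<close> with
  \<open>insert j S\<close> switches between the two.\<close>

lemma sum_over_remaining: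
  fixes f :: "'v::finite \<Rightarrow> 'v set \<Rightarrow> real"
  assumes "\<And>j S. j \<in> S \<Longrightarrow> f j S = 0"
  shows "(\<Sum>j\<in>UNIV. \<Sum>S\<in>UNIV. f j S) = (\<Sum>S\<in>UNIV. \<Sum>j\<in>S. f j (S - {j}))"
proof -
  have "(\<Sum>j\<in>UNIV. \<Sum>S\<in>UNIV. f j S) = (\<Sum>S\<in>UNIV. \<Sum>j\<in>UNIV. f j S)"
    by (rule sum.swap)
  also have "\<dots> = (\<Sum>S\<in>UNIV. \<Sum>j\<in>-S. f j S)"
    by (intro sum.cong sum.mono_neutral_right refl) (auto simp: assms)
  finally show ?thesis by (simp add: sum_remove_reindex)
qed

section \<open>Flows\<close>

text \<open>The probability weight arriving in state \<open>S\<close>, times the chance 1/n of a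
  given type. The first stage \<open>CARD('i)\<close> starts in \<open>UNIV\<close> with weight
  1.\<close>

definition inflow ::
  "(nat \<Rightarrow> 'i::finite \<Rightarrow> 'v::finite \<Rightarrow> 'v set \<Rightarrow> real) \<Rightarrow> (nat \<Rightarrow> 'i \<Rightarrow> 'v set \<Rightarrow> real)
    \<Rightarrow> nat \<Rightarrow> 'v set \<Rightarrow> real"
where
  "inflow x y \<tau> S =
     (if \<tau> = CARD('i) then of_bool (S = UNIV)
      else (\<Sum>k\<in>UNIV. y (Suc \<tau>) k S) + (\<Sum>k\<in>UNIV. \<Sum>j\<in>-S. x (Suc \<tau>) k j S)) / real CARD('i)"

text \<open>
  With all variables outside their index ranges set to zero, the constraints (a), (b) and (c) take
  one common form.
\<close>

definition flow ::
  "(nat \<Rightarrow> 'i::finite \<Rightarrow> 'v::finite \<Rightarrow> 'v set \<Rightarrow> real) \<Rightarrow> (nat \<Rightarrow> 'i \<Rightarrow> 'v set \<Rightarrow> real) \<Rightarrow> bool"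
where
  "flow x y \<longleftrightarrow>
     (\<forall>\<tau> i j S. 0 \<le> x \<tau> i j S \<and> (x \<tau> i j S \<noteq> 0 \<longrightarrow> j \<notin> S \<and> \<tau> \<le> card S + 1)) \<and>
     (\<forall>\<tau> i S. 0 \<le> y \<tau> i S \<and> (y \<tau> i S \<noteq> 0 \<longrightarrow> \<tau> \<le> card S)) \<and>
     (\<forall>\<tau>\<in>{1..CARD('i)}. \<forall>i S. (\<Sum>j\<in>S. x \<tau> i j (S - {j})) + y \<tau> i S \<le> inflow x y \<tau> S)"

text \<open>The indicators in (b) and (c) do no harm: where \<open>card S > \<tau>\<close> fails,
  the support condition of \<open>flow\<close> makes the \<open>y\<close> in question vanish, and
  dropping \<open>y\<close> in stage 1 only lowers the left-hand side.\<close>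

lemma flow_feasible:
  fixes x :: "nat \<Rightarrow> 'i::finite \<Rightarrow> 'v::finite \<Rightarrow> 'v set \<Rightarrow> real"
  assumes "flow x y"
  shows "feasible x y"
proof -
  let ?n = "CARD('i)"
  have x0: "0 \<le> x \<tau> i j S" and y0: "0 \<le> y \<tau> i S" and y1: "y \<tau> i S \<noteq> 0 \<Longrightarrow> \<tau> \<le> card S"
    for \<tau> i j S using assms by (auto simp: flow_def)
  have bal: "(\<Sum>j\<in>S. x \<tau> i j (S - {j})) + y \<tau> i S \<le> inflow x y \<tau> S"
    if "\<tau> \<in> {1..?n}" for \<tau> i S using assms that by (auto simp: flow_def)
  have a: "(\<Sum>j\<in>UNIV. x ?n i j (UNIV - {j})) + y ?n i UNIV \<le> 1 / real ?n" for i
    using bal[where \<tau> = "?n" and S = UNIV and i = i] by (simp add: inflow_def Suc_le_eq)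
  have b: "(\<Sum>j\<in>S. x \<tau> i j (S - {j})) + y \<tau> i S * of_bool (\<tau> \<noteq> 1)
          - 1 / real ?n * of_bool (card S > \<tau>) * (\<Sum>k\<in>UNIV. y (\<tau> + 1) k S)
          - 1 / real ?n * (\<Sum>k\<in>UNIV. \<Sum>j\<in>UNIV - S. x (\<tau> + 1) k j S) \<le> 0"
    if "\<tau> \<in> {1..?n-1}" for \<tau> i S
  proof -
    have \<tau>: "\<tau> \<in> {1..?n}" "\<tau> \<noteq> ?n"
      using that zero_less_card_finite[where 'a = 'i] unfolding atLeastAtMost_iff by linarith+
    have e: "of_bool (card S > \<tau>) * (\<Sum>k\<in>UNIV. y (\<tau> + 1) k S) = (\<Sum>k\<in>UNIV. y (\<tau> + 1) k S)"
      using y1[of "Suc \<tau>" _ S] by (cases "card S > \<tau>") (auto simp: Suc_le_eq intro!: sum.neutral)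
    have "y \<tau> i S * of_bool (\<tau> \<noteq> 1) \<le> y \<tau> i S"
      using y0 by simp
    moreover have "(\<Sum>j\<in>S. x \<tau> i j (S - {j})) + y \<tau> i S
        \<le> 1 / real ?n * (\<Sum>k\<in>UNIV. y (\<tau> + 1) k S) + 1 / real ?n * (\<Sum>k\<in>UNIV. \<Sum>j\<in>UNIV - S. x (\<tau> + 1) k j S)"
      using bal[where \<tau> = \<tau> and S = S and i = i] \<tau> by (auto simp: inflow_def add_divide_distrib Compl_eq_Diff_UNIV)
    ultimately show ?thesis unfolding mult.assoc e by linarith
  qed
  have c: "(\<Sum>j\<in>UNIV. x \<tau> i j (UNIV - {j})) + y \<tau> i UNIV * of_bool (\<tau> \<noteq> 1)
          - 1 / real ?n * (\<Sum>k\<in>UNIV. y (\<tau> + 1) k UNIV) \<le> 0"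
    if "\<tau> \<in> {1..?n-1}" for \<tau> i
  proof -
    have \<tau>: "\<tau> \<in> {1..?n}" "\<tau> \<noteq> ?n"
      using that zero_less_card_finite[where 'a = 'i] unfolding atLeastAtMost_iff by linarith+
    have "y \<tau> i UNIV * of_bool (\<tau> \<noteq> 1) \<le> y \<tau> i UNIV"
      using y0 by simp
    moreover have "(\<Sum>j\<in>UNIV. x \<tau> i j (UNIV - {j})) + y \<tau> i UNIV \<le> 1 / real ?n * (\<Sum>k\<in>UNIV. y (\<tau> + 1) k UNIV)"
      using bal[where \<tau> = \<tau> and S = UNIV and i = i] \<tau> by (auto simp: inflow_def)
    ultimately show ?thesis by linarith
  qed
  show ?thesis unfolding feasible_def Let_def using x0 y0 a b c by blast
qed

text \<open>Constraints (b) and (c) put no upper bound on discards in stage 1, where they are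
  multiplied by 0; therefore \<open>y'\<close> starts at stage 2. The projected point depends only
  on the values of \<open>x\<close> in range, so the truncation leaves it unchanged.\<close>

lemma feasible_flow:
  fixes x :: "nat \<Rightarrow> 'i::finite \<Rightarrow> 'v::finite \<Rightarrow> 'v set \<Rightarrow> real"
  assumes "CARD('v) = CARD('i)" and "feasible x y"
  defines "x' \<equiv> \<lambda>\<tau> i j S. if \<tau> \<in> {1..CARD('i)} \<and> j \<notin> S \<and> \<tau> \<le> card S + 1 then x \<tau> i j S else 0"
    and "y' \<equiv> \<lambda>\<tau> i S. if \<tau> \<in> {2..CARD('i)} \<and> \<tau> \<le> card S then y \<tau> i S else 0"
  shows "flow x' y'"
proof -
  let ?n = "CARD('i)"
  have npos: "?n > 0" by simp
  note feas = assms(2)[unfolded feasible_def Let_def]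
  note feas1 = feas[THEN conjunct1]
    and feas2 = feas[THEN conjunct2, THEN conjunct1]
    and feas3 = feas[THEN conjunct2, THEN conjunct2, THEN conjunct1]
    and feas4 = feas[THEN conjunct2, THEN conjunct2, THEN conjunct2, THEN conjunct1]
    and feas5 = feas[THEN conjunct2, THEN conjunct2, THEN conjunct2, THEN conjunct2]
  have fx: "x \<tau> i j S \<ge> 0" if "\<tau> \<in> {1..?n}" "j \<notin> S" "\<tau> \<le> card S + 1" for \<tau> i j S
  proof -
    have "S \<subseteq> UNIV - {j} \<and> card S \<ge> \<tau> - 1" using that by auto
    then show ?thesis using feas1 that(1) by simp
  qed
  have fy: "y \<tau> i S \<ge> 0" if "\<tau> \<in> {1..?n}" "\<tau> \<le> card S" for \<tau> i S
    using feas2 that by simp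
  have fa: "(\<Sum>j\<in>UNIV. x ?n i j (UNIV - {j})) + y ?n i UNIV \<le> 1 / real ?n" for i
    using feas3 by simp
  have fb: "(\<Sum>j\<in>S. x \<tau> i j (S - {j})) + y \<tau> i S * of_bool (\<tau> \<noteq> 1)
          - 1 / real ?n * of_bool (card S > \<tau>) * (\<Sum>k\<in>UNIV. y (\<tau> + 1) k S)
          - 1 / real ?n * (\<Sum>k\<in>UNIV. \<Sum>j\<in>UNIV - S. x (\<tau> + 1) k j S) \<le> 0"
    if "\<tau> \<in> {1..?n-1}" "S \<noteq> {}" "S \<noteq> UNIV" "card S \<ge> \<tau>" for \<tau> i S
    using feas4 that by (simp add: psubset_eq)
  have fc: "(\<Sum>j\<in>UNIV. x \<tau> i j (UNIV - {j})) + y \<tau> i UNIV * of_bool (\<tau> \<noteq> 1)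
          - 1 / real ?n * (\<Sum>k\<in>UNIV. y (\<tau> + 1) k UNIV) \<le> 0" if "\<tau> \<in> {1..?n-1}" for \<tau> i
    using feas5 that by simp
  have x0: "0 \<le> x' \<tau> i j S" for \<tau> i j S
    using fx by (simp add: x'_def)
  have y0: "0 \<le> y' \<tau> i S" for \<tau> i S
    using fy by (simp add: y'_def)
  have inflow0: "0 \<le> inflow x' y' \<tau> S" for \<tau> S
    unfolding inflow_def using x0 y0 by (auto intro!: divide_nonneg_nonneg sum_nonneg add_nonneg_nonneg)
  have bal: "(\<Sum>j\<in>S. x' \<tau> i j (S - {j})) + y' \<tau> i S \<le> inflow x' y' \<tau> S" if \<tau>: "\<tau> \<in> {1..?n}" for \<tau> i S
  \<comment> \<open>With fewer than \<open>\<tau>\<close> ads every move is out of range, so the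
    left-hand side is zero.\<close>
  proof (cases "card S < \<tau>")
    case True
    have "x' \<tau> i j (S - {j}) = 0" if "j \<in> S" for j
      using True that card_gt_0_iff[of S] by (auto simp: x'_def card_Diff_singleton)
    moreover have "y' \<tau> i S = 0" using True by (auto simp: y'_def)
    ultimately show ?thesis using inflow0 by simp
  next
    case False
    then have Sne: "S \<noteq> {}" using \<tau> by auto
    have xeq: "(\<Sum>j\<in>S. x' \<tau> i j (S - {j})) = (\<Sum>j\<in>S. x \<tau> i j (S - {j}))"
      using False \<tau> by (intro sum.cong) (auto simp: x'_def card_Diff_singleton)
    have yle: "y' \<tau> i S \<le> y \<tau> i S * of_bool (\<tau> \<noteq> 1)"
      using False \<tau> by (auto simp: y'_def)
    show ?thesis
    proof (cases "\<tau> = ?n")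
      case True
      then have "card S \<ge> CARD('v)" using False assms(1) by simp
      then have S: "S = UNIV" by (metis card_seteq finite subset_UNIV)
      have "y' ?n i UNIV \<le> y ?n i UNIV"
        using fy[of ?n UNIV i] assms(1) npos by (simp add: y'_def Suc_le_eq)
      then show ?thesis using True S xeq fa[of i] by (simp add: inflow_def)
    next
      case False': False
      then have \<tau>': "\<tau> \<in> {1..?n-1}" using \<tau> by auto
      have sx: "(\<Sum>k\<in>UNIV. \<Sum>j\<in>-S. x' (Suc \<tau>) k j S) = (\<Sum>k\<in>UNIV. \<Sum>j\<in>UNIV - S. x (\<tau> + 1) k j S)"
        using False \<tau>' by (auto intro!: sum.cong simp: x'_def Compl_eq_Diff_UNIV)
      have sy: "(\<Sum>k\<in>UNIV. y' (Suc \<tau>) k S) = of_bool (card S > \<tau>) * (\<Sum>k\<in>UNIV. y (\<tau> + 1) k S)"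
        using \<tau>' by (cases "card S > \<tau>") (auto simp: y'_def Suc_le_eq intro!: sum.cong)
      show ?thesis
      proof (cases "S = UNIV")
        case True
        have "(\<Sum>j\<in>UNIV. x \<tau> i j (UNIV - {j})) + y \<tau> i UNIV * of_bool (\<tau> \<noteq> 1)
          \<le> 1 / real ?n * (\<Sum>k\<in>UNIV. y (\<tau> + 1) k UNIV)"
          using fc[of \<tau> i] \<tau>' by simp
        moreover have "card S > \<tau>" using True \<tau>' assms(1) by auto
        ultimately show ?thesis
          using xeq yle False' using sy[unfolded True] by (simp add: inflow_def True)
      next
        case S: False
        then have "(\<Sum>j\<in>S. x \<tau> i j (S - {j})) + y \<tau> i S * of_bool (\<tau> \<noteq> 1)
          - 1 / real ?n * of_bool (card S > \<tau>) * (\<Sum>k\<in>UNIV. y (\<tau> + 1) k S)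
          - 1 / real ?n * (\<Sum>k\<in>UNIV. \<Sum>j\<in>UNIV - S. x (\<tau> + 1) k j S) \<le> 0"
          using fb[of \<tau> S i] \<tau>' False Sne by simp
        then show ?thesis
          using xeq yle False' by (simp add: inflow_def sx sy add_divide_distrib)
      qed
    qed
  qed
  show ?thesis unfolding flow_def using x0 y0 bal by (auto simp: x'_def y'_def)
qed

lemma stage_no_range: "stage_no (\<sigma> :: 'i::finite stage) \<in> {1..CARD('i)}"
  by (rule stage_no)

lemma achievable_iff_flow:
  fixes z :: "real ^ ('i::finite \<times> 'v::finite \<times> 'i stage)"
  assumes "CARD('v) = CARD('i)"
  shows "z \<in> achievable \<longleftrightarrow>
    (\<exists>x y. flow x y \<and> (\<forall>i j \<sigma>. z $ (i, j, \<sigma>) = (\<Sum>S\<in>UNIV. x (stage_no \<sigma>) i j S)))"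
proof
  assume "z \<in> achievable"
  then obtain x y where feas: "feasible x y" and z: "\<And>i j \<sigma>. z $ (i, j, \<sigma>) =
     (\<Sum>S | S \<subseteq> UNIV - {j} \<and> card S \<ge> stage_no \<sigma> - 1. x (stage_no \<sigma>) i j S)"
    unfolding achievable_def by blast
  show "\<exists>x y. flow x y \<and> (\<forall>i j \<sigma>. z $ (i, j, \<sigma>) = (\<Sum>S\<in>UNIV. x (stage_no \<sigma>) i j S))"
  proof (intro exI conjI allI)
    show "flow (\<lambda>\<tau> i j S. if \<tau> \<in> {1..CARD('i)} \<and> j \<notin> S \<and> \<tau> \<le> card S + 1 then x \<tau> i j S else 0)
      (\<lambda>\<tau> i S. if \<tau> \<in> {2..CARD('i)} \<and> \<tau> \<le> card S then y \<tau> i S else 0)"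
      by (rule feasible_flow[OF assms feas])
    fix i j \<sigma>
    show "z $ (i, j, \<sigma>) = (\<Sum>S\<in>UNIV. if stage_no \<sigma> \<in> {1..CARD('i)} \<and> j \<notin> S \<and> stage_no \<sigma> \<le> card S + 1
        then x (stage_no \<sigma>) i j S else 0)"
      unfolding z using stage_no_range[of \<sigma>]
      by (intro sum.mono_neutral_cong_left) (auto simp: le_diff_conv)
  qed
next
  assume "\<exists>x y. flow x y \<and> (\<forall>i j \<sigma>. z $ (i, j, \<sigma>) = (\<Sum>S\<in>UNIV. x (stage_no \<sigma>) i j S))"
  then obtain x y where fl: "flow x y" and z: "\<And>i j \<sigma>. z $ (i, j, \<sigma>) = (\<Sum>S\<in>UNIV. x (stage_no \<sigma>) i j S)"
    by blast
  have "z $ (i, j, \<sigma>) =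
     (\<Sum>S | S \<subseteq> UNIV - {j} \<and> card S \<ge> stage_no \<sigma> - 1. x (stage_no \<sigma>) i j S)" for i j \<sigma>
    unfolding z
  proof (rule sum.mono_neutral_right)
    have "x \<tau> i j S \<noteq> 0 \<Longrightarrow> j \<notin> S \<and> \<tau> \<le> card S + 1" for \<tau> S
      using fl unfolding flow_def by blast
    then show "\<forall>S\<in>UNIV - {S. S \<subseteq> UNIV - {j} \<and> card S \<ge> stage_no \<sigma> - 1}. x (stage_no \<sigma>) i j S = 0"
      by force
  qed auto
  then show "z \<in> achievable" unfolding achievable_def using flow_feasible[OF fl] by blast
qed

text \<open>On the right each move of stage \<open>Suc \<tau>\<close> counts with the weight
  \<open>w\<close> of the state it leads to. With a value function for \<open>w\<close> this makes
  the stages telescope.\<close>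

lemma sum_inflow:
  fixes x :: "nat \<Rightarrow> 'i::finite \<Rightarrow> 'v::finite \<Rightarrow> 'v set \<Rightarrow> real"
  assumes "\<tau> < CARD('i)"
  shows "real CARD('i) * (\<Sum>S\<in>UNIV. inflow x y \<tau> S * w S) =
    (\<Sum>S\<in>UNIV. \<Sum>i\<in>UNIV. (\<Sum>j\<in>S. x (Suc \<tau>) i j (S - {j}) * w (S - {j})) + y (Suc \<tau>) i S * w S)"
proof -
  have "real CARD('i) * (\<Sum>S\<in>UNIV. inflow x y \<tau> S * w S) =
    (\<Sum>S\<in>UNIV. (\<Sum>k\<in>UNIV. y (Suc \<tau>) k S * w S) + (\<Sum>k\<in>UNIV. \<Sum>j\<in>-S. x (Suc \<tau>) k j S * w S))"
    using assms by (simp add: inflow_def sum_distrib_left sum_distrib_right distrib_right)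
  also have "\<dots> = (\<Sum>k\<in>UNIV. \<Sum>S\<in>UNIV. \<Sum>j\<in>-S. x (Suc \<tau>) k j S * w S) + (\<Sum>S\<in>UNIV. \<Sum>k\<in>UNIV. y (Suc \<tau>) k S * w S)"
    unfolding sum.distrib by (subst (2) sum.swap) (rule add.commute)
  also have "(\<Sum>k\<in>UNIV. \<Sum>S\<in>UNIV. \<Sum>j\<in>-S. x (Suc \<tau>) k j S * w S) =
      (\<Sum>k\<in>UNIV. \<Sum>S\<in>UNIV. \<Sum>j\<in>S. x (Suc \<tau>) k j (S - {j}) * w (S - {j}))"
    by (simp add: sum_remove_reindex)
  also have "\<dots> = (\<Sum>S\<in>UNIV. \<Sum>k\<in>UNIV. \<Sum>j\<in>S. x (Suc \<tau>) k j (S - {j}) * w (S - {j}))"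
    by (rule sum.swap)
  finally show ?thesis by (simp add: sum.distrib)
qed

section \<open>Dynamic programming\<close>

definition moves :: "'v set \<Rightarrow> 'v option set" where
  "moves S = insert None (Some ` S)"

definition rest :: "'v set \<Rightarrow> 'v option \<Rightarrow> 'v set" where
  "rest S A = (case A of None \<Rightarrow> S | Some j \<Rightarrow> S - {j})"

definition gain :: "(nat \<Rightarrow> 'i \<Rightarrow> 'v \<Rightarrow> real) \<Rightarrow> nat \<Rightarrow> 'i \<Rightarrow> 'v option \<Rightarrow> real" where
  "gain c \<tau> i A = (case A of None \<Rightarrow> 0 | Some j \<Rightarrow> c \<tau> i j)"

lemma rest_simps [simp]: "rest S None = S" "rest S (Some j) = S - {j}"
  by (simp_all add: rest_def)

lemma gain_simps [simp]: "gain c \<tau> i None = 0" "gain c \<tau> i (Some j) = c \<tau> i j"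
  by (simp_all add: gain_def)

lemma gain_uminus: "gain (\<lambda>\<tau> i j. - c \<tau> i j) \<tau> i A = - gain c \<tau> i A"
  by (cases A) auto

text \<open>The value before the type of stage \<open>\<tau>\<close> is drawn, with moves restricted
  to \<open>D\<close>. One recursion thus covers the optimum (all moves), a fixed policy
  (singletons), and the optimum of one objective among the best moves of another.\<close>

primrec opt :: "(nat \<Rightarrow> 'i::finite \<Rightarrow> 'v::finite set \<Rightarrow> 'v option set) \<Rightarrow> (nat \<Rightarrow> 'i \<Rightarrow> 'v \<Rightarrow> real)
    \<Rightarrow> nat \<Rightarrow> 'v set \<Rightarrow> real"
where
  "opt D c 0 = (\<lambda>S. 0)"
| "opt D c (Suc \<tau>) = (\<lambda>S. (\<Sum>i\<in>UNIV.
      Max ((\<lambda>A. gain c (Suc \<tau>) i A + opt D c \<tau> (rest S A)) ` D (Suc \<tau>) i S)) / real CARD('i))"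

abbreviation optval :: "(nat \<Rightarrow> 'i::finite \<Rightarrow> 'v::finite \<Rightarrow> real) \<Rightarrow> nat \<Rightarrow> 'v set \<Rightarrow> real" where
  "optval \<equiv> opt (\<lambda>_ _. moves)"

abbreviation pval :: "(nat \<Rightarrow> 'i::finite \<Rightarrow> 'v::finite set \<Rightarrow> 'v option) \<Rightarrow> (nat \<Rightarrow> 'i \<Rightarrow> 'v \<Rightarrow> real)
    \<Rightarrow> nat \<Rightarrow> 'v set \<Rightarrow> real" where
  "pval \<pi> \<equiv> opt (\<lambda>\<tau> i S. {\<pi> \<tau> i S})"

text \<open>Nonempty for every stage number, so that policies can be chosen as total functions; at
  stage 0 the truncated \<open>\<tau> - 1\<close> merely gives a harmless value.\<close>

definition best :: "(nat \<Rightarrow> 'i::finite \<Rightarrow> 'v::finite \<Rightarrow> real) \<Rightarrow> nat \<Rightarrow> 'i \<Rightarrow> 'v set \<Rightarrow> 'v option set" where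
  "best c \<tau> i S = {A \<in> moves S. \<forall>B\<in>moves S.
     gain c \<tau> i B + optval c (\<tau> - 1) (rest S B) \<le> gain c \<tau> i A + optval c (\<tau> - 1) (rest S A)}"

lemma finite_argmax:
  fixes f :: "'a \<Rightarrow> real"
  assumes "finite A" "A \<noteq> {}"
  shows "\<exists>a\<in>A. f a = Max (f ` A)"
proof -
  have "Max (f ` A) \<in> f ` A" using assms by simp
  then show ?thesis by auto
qed

lemma best_nonempty: "best c \<tau> i S \<noteq> {}"
proof -
  let ?f = "\<lambda>A. gain c \<tau> i A + optval c (\<tau> - 1) (rest S A)"
  have "\<exists>A\<in>moves S. ?f A = Max (?f ` moves S)"
    by (rule finite_argmax) (auto simp: moves_def)
  then obtain A where A: "A \<in> moves S" "?f A = Max (?f ` moves S)" ..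
  then have "\<forall>B\<in>moves S. ?f B \<le> ?f A" by simp
  then show ?thesis using A(1) by (auto simp: best_def)
qed

lemma best_subset_moves: "best c \<tau> i S \<subseteq> moves S"
  by (auto simp: best_def)

lemma Max_best:
  assumes "A \<in> best c (Suc \<tau>) i S"
  shows "Max ((\<lambda>B. gain c (Suc \<tau>) i B + optval c \<tau> (rest S B)) ` moves S)
    = gain c (Suc \<tau>) i A + optval c \<tau> (rest S A)"
  using assms by (intro Max_eqI) (auto simp: best_def)

lemma pval_best:
  assumes "\<And>\<tau> i S. \<pi> \<tau> i S \<in> best c \<tau> i S"
  shows "pval \<pi> c \<tau> S = optval c \<tau> S"
proof (induction \<tau> arbitrary: S)
  case (Suc \<tau>)
  then show ?case using Max_best[OF assms] by simp
qed simp

lemma optval_nonneg: "0 \<le> optval c \<tau> S"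
proof (induction \<tau> arbitrary: S)
  case (Suc \<tau>)
  have "0 \<le> Max ((\<lambda>A. gain c (Suc \<tau>) i A + optval c \<tau> (rest S A)) ` moves S)" for i
    by (rule Max_ge_iff[THEN iffD2]) (auto simp: moves_def Suc)
  then show ?case by (auto intro!: sum_nonneg divide_nonneg_nonneg)
qed simp

text \<open>Lets minimisation over policies be treated as maximisation; a fixed policy leaves no
  choice, so the sign passes through the recursion.\<close>

lemma pval_uminus: "pval \<pi> (\<lambda>\<tau> i j. - c \<tau> i j) \<tau> S = - pval \<pi> c \<tau> S"
proof (induction \<tau> arbitrary: S)
  case (Suc \<tau>)
  have "- gain c (Suc \<tau>) i A + - pval \<pi> c \<tau> (rest S A) = - (gain c (Suc \<tau>) i A + pval \<pi> c \<tau> (rest S A))" for i A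
    by simp
  then show ?case
    by (simp only: opt.simps image_insert image_empty Max_singleton Suc gain_uminus sum_negf minus_divide_left)
qed simp

lemma opt_attained:
  fixes D :: "nat \<Rightarrow> 'i::finite \<Rightarrow> 'v::finite set \<Rightarrow> 'v option set"
  assumes "\<And>\<tau> i S. D \<tau> i S \<noteq> {}"
  obtains \<pi> where "\<And>\<tau> i S. \<pi> \<tau> i S \<in> D \<tau> i S" "\<And>\<tau> S. pval \<pi> c \<tau> S = opt D c \<tau> S"
proof -
  let ?f = "\<lambda>\<tau> i S A. gain c \<tau> i A + opt D c (\<tau> - 1) (rest S A)"
  have "\<exists>A\<in>D \<tau> i S. ?f \<tau> i S A = Max (?f \<tau> i S ` D \<tau> i S)" for \<tau> i S
    by (rule finite_argmax) (auto simp: assms)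
  then have ex: "\<exists>A. A \<in> D \<tau> i S \<and> ?f \<tau> i S A = Max (?f \<tau> i S ` D \<tau> i S)" for \<tau> i S
    by blast
  define \<pi> where "\<pi> = (\<lambda>\<tau> i S. SOME A. A \<in> D \<tau> i S \<and> ?f \<tau> i S A = Max (?f \<tau> i S ` D \<tau> i S))"
  have \<pi>: "\<pi> \<tau> i S \<in> D \<tau> i S" "?f \<tau> i S (\<pi> \<tau> i S) = Max (?f \<tau> i S ` D \<tau> i S)" for \<tau> i S
    using someI_ex[OF ex[of \<tau> i S]] unfolding \<pi>_def by blast+
  have "pval \<pi> c \<tau> S = opt D c \<tau> S" for \<tau> S
  proof (induction \<tau> arbitrary: S)
    case (Suc \<tau>)
    then show ?case using \<pi>(2)[of "Suc \<tau>"] by simp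
  qed simp
  with \<pi>(1) show ?thesis by (rule that)
qed

text \<open>The index is the stage about to be played; index 0 is the situation after the last
  stage.\<close>

inductive reach :: "(nat \<Rightarrow> 'i::finite \<Rightarrow> 'v::finite set \<Rightarrow> 'v option set) \<Rightarrow> nat \<Rightarrow> 'v set \<Rightarrow> bool"
  for D where
  start: "reach D CARD('i) UNIV"
| step: "reach D (Suc \<tau>) S \<Longrightarrow> A \<in> D (Suc \<tau>) i S \<Longrightarrow> reach D \<tau> (rest S A)"

text \<open>
  The best and the worst policy within \<open>D\<close> tie at the start; since both values are averages over
  the successor states, they tie at every reachable state and for every move.
\<close>

lemma moves_tie:
  fixes D :: "nat \<Rightarrow> 'i::finite \<Rightarrow> 'v::finite set \<Rightarrow> 'v option set"
  assumes ne: "\<And>\<tau> i S. D \<tau> i S \<noteq> {}"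
    and const: "\<And>\<pi>. (\<And>\<tau> i S. \<pi> \<tau> i S \<in> D \<tau> i S) \<Longrightarrow> pval \<pi> c CARD('i) UNIV = b"
    and "reach D (Suc \<tau>) S" "A \<in> D (Suc \<tau>) i S" "B \<in> D (Suc \<tau>) i S"
  shows "gain c (Suc \<tau>) i A + opt D c \<tau> (rest S A) = gain c (Suc \<tau>) i B + opt D c \<tau> (rest S B)"
proof -
  \<comment> \<open>The least value attainable within \<open>D\<close>, written as a maximum for the
    negated objective.\<close>
  define lo where "lo = (\<lambda>\<tau> S. - opt D (\<lambda>\<tau> i j. - c \<tau> i j) \<tau> S)"
  let ?c' = "\<lambda>\<tau> i j. - c \<tau> i j"
  let ?u = "\<lambda>\<tau> i S A. gain c (Suc \<tau>) i A + opt D c \<tau> (rest S A)"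
  let ?l = "\<lambda>\<tau> i S A. gain c (Suc \<tau>) i A + lo \<tau> (rest S A)"
  let ?l' = "\<lambda>\<tau> i S A. gain ?c' (Suc \<tau>) i A + opt D ?c' \<tau> (rest S A)"
  have l': "?l' \<tau> i S A = - ?l \<tau> i S A" for \<tau> i S A
    by (simp add: gain_uminus lo_def)
  define mx where "mx = (\<lambda>\<tau> i S. Max (?u \<tau> i S ` D (Suc \<tau>) i S))"
  define mn where "mn = (\<lambda>\<tau> i S. - Max (?l' \<tau> i S ` D (Suc \<tau>) i S))"
  have mx: "?u \<tau> i S A \<le> mx \<tau> i S" if "A \<in> D (Suc \<tau>) i S" for \<tau> i S A
    unfolding mx_def using that by (intro Max_ge) auto
  have mn: "mn \<tau> i S \<le> ?l \<tau> i S A" if "A \<in> D (Suc \<tau>) i S" for \<tau> i S A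
  proof -
    have "?l' \<tau> i S A \<le> Max (?l' \<tau> i S ` D (Suc \<tau>) i S)"
      using that by (intro Max_ge) auto
    then show ?thesis unfolding mn_def l' by linarith
  qed
  have hi_eq: "opt D c (Suc \<tau>) S = (\<Sum>i\<in>UNIV. mx \<tau> i S) / real CARD('i)" for \<tau> S
    by (simp add: mx_def)
  have lo_eq: "lo (Suc \<tau>) S = (\<Sum>i\<in>UNIV. mn \<tau> i S) / real CARD('i)" for \<tau> S
    by (simp add: mn_def lo_def sum_negf flip: minus_divide_left)
  have lohi: "lo \<tau> S \<le> opt D c \<tau> S" and mnmx: "mn \<tau> i S \<le> mx \<tau> i S" for \<tau> S i
  proof -
    have *: "mn \<tau> i S \<le> mx \<tau> i S" if "\<And>S. lo \<tau> S \<le> opt D c \<tau> S" for \<tau> i S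
    proof -
      obtain A where "A \<in> D (Suc \<tau>) i S" using ne by blast
      then show ?thesis using mx[of A \<tau> i S] mn[of A \<tau> i S] that[of "rest S A"] by linarith
    qed
    have **: "lo \<tau> S \<le> opt D c \<tau> S" for \<tau> S
    proof (induction \<tau> arbitrary: S)
      case 0
      then show ?case by (simp add: lo_def)
    next
      case (Suc \<tau>)
      show ?case unfolding hi_eq lo_eq by (intro divide_right_mono sum_mono *[OF Suc]) simp
    qed
    show "lo \<tau> S \<le> opt D c \<tau> S" by (rule **)
    show "mn \<tau> i S \<le> mx \<tau> i S" by (intro * **)
  qed
  \<comment> \<open>Both values are averages over the types, and \<open>mn\<close> is below
    \<open>mx\<close> for each type, so equal averages force equality type by type.\<close>
  have tie: "mn \<tau> i S = mx \<tau> i S" if "lo (Suc \<tau>) S = opt D c (Suc \<tau>) S" for \<tau> i S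
  proof -
    have "(\<Sum>i\<in>UNIV. mx \<tau> i S - mn \<tau> i S) = 0"
      using that unfolding hi_eq lo_eq by (simp add: sum_subtractf)
    then show ?thesis using mnmx[of \<tau> _ S] by (subst (asm) sum_nonneg_eq_0_iff) auto
  qed
  have reach_tie: "lo \<tau> S = opt D c \<tau> S" if "reach D \<tau> S" for \<tau> S
    using that
  proof induction
    \<comment> \<open>Both extremes are attained by policies within \<open>D\<close>, and all of
      these have the value \<open>b\<close>.\<close>
    case start
    obtain \<pi> where \<pi>: "\<And>\<tau> i S. \<pi> \<tau> i S \<in> D \<tau> i S" "\<And>\<tau> S. pval \<pi> c \<tau> S = opt D c \<tau> S"
      using opt_attained[of D, OF ne] by blast
    obtain \<rho> where \<rho>: "\<And>\<tau> i S. \<rho> \<tau> i S \<in> D \<tau> i S" "\<And>\<tau> S. pval \<rho> ?c' \<tau> S = opt D ?c' \<tau> S"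
      using opt_attained[of D, OF ne] by blast
    have "lo CARD('i) UNIV = pval \<rho> c CARD('i) UNIV"
      by (simp only: lo_def \<rho>(2)[symmetric] pval_uminus minus_minus)
    then show ?case using const[OF \<pi>(1)] const[OF \<rho>(1)] \<pi>(2) by metis
  next
    case (step \<tau> S A i)
    then show ?case
      using tie[OF step.IH, of i] mx[OF step.hyps(2)] mn[OF step.hyps(2)] lohi[of \<tau> "rest S A"] by linarith
  qed
  \<comment> \<open>The successor state is reachable too, so there \<open>?u\<close> and
    \<open>?l\<close> agree and are squeezed between \<open>mn\<close> and \<open>mx\<close>, which
    coincide.\<close>
  have "?u \<tau> i S A' = mx \<tau> i S" if "A' \<in> D (Suc \<tau>) i S" for A'
    using tie[OF reach_tie[OF assms(3)], of i] mx[OF that] mn[OF that]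
      reach_tie[OF reach.step[OF assms(3) that]] by linarith
  then show ?thesis using assms(4,5) by simp
qed

text \<open>All moves that are best for \<open>c\<close> have the same value under \<open>a\<close>,
  namely \<open>k\<close> times the maximum for \<open>c\<close>. The maximum is thus over a single
  number, and \<open>k\<close> may be negative.\<close>

lemma opt_scale:
  fixes c :: "nat \<Rightarrow> 'i::finite \<Rightarrow> 'v::finite \<Rightarrow> real"
  assumes "\<And>\<sigma> i j. \<sigma> \<in> {1..\<tau>} \<Longrightarrow> a \<sigma> i j = k * c \<sigma> i j"
  shows "opt (best c) a \<tau> S = k * optval c \<tau> S"
  using assms
proof (induction \<tau> arbitrary: S)
  case (Suc \<tau>)
  have *: "Max ((\<lambda>A. gain a (Suc \<tau>) i A + opt (best c) a \<tau> (rest S A)) ` best c (Suc \<tau>) i S)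
    = k * Max ((\<lambda>A. gain c (Suc \<tau>) i A + optval c \<tau> (rest S A)) ` moves S)" for i
  proof -
    have g: "gain a (Suc \<tau>) i A = k * gain c (Suc \<tau>) i A" for A
      using Suc.prems by (cases A) auto
    have "gain a (Suc \<tau>) i A + opt (best c) a \<tau> (rest S A)
        = k * Max ((\<lambda>A. gain c (Suc \<tau>) i A + optval c \<tau> (rest S A)) ` moves S)"
      if "A \<in> best c (Suc \<tau>) i S" for A
      using Max_best[OF that] Suc g by (simp add: distrib_left)
    then have "(\<lambda>A. gain a (Suc \<tau>) i A + opt (best c) a \<tau> (rest S A)) ` best c (Suc \<tau>) i S
        = {k * Max ((\<lambda>A. gain c (Suc \<tau>) i A + optval c \<tau> (rest S A)) ` moves S)}"
      using best_nonempty[of c "Suc \<tau>" i S] by auto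
    then show ?thesis by simp
  qed
  show ?case by (simp only: opt.simps *) (simp flip: sum_distrib_left)
qed simp

section \<open>Linear functionals on achievable points\<close>

definition lin :: "(nat \<Rightarrow> 'i::finite \<Rightarrow> 'v::finite \<Rightarrow> real) \<Rightarrow> real ^ ('i \<times> 'v \<times> 'i stage) \<Rightarrow> real" where
  "lin c z = (\<Sum>\<tau>=1..CARD('i). \<Sum>i\<in>UNIV. \<Sum>j\<in>UNIV. c \<tau> i j * z $ (i, j, Stage \<tau>))"

definition coeffs :: "(nat \<Rightarrow> 'i::finite \<Rightarrow> 'v::finite \<Rightarrow> real) \<Rightarrow> real ^ ('i \<times> 'v \<times> 'i stage)" where
  "coeffs c = (\<chi> p. c (stage_no (snd (snd p))) (fst p) (fst (snd p)))"

lemma stage_no_Stage: "\<tau> \<in> {1..CARD('i::finite)} \<Longrightarrow> stage_no (Stage \<tau> :: 'i stage) = \<tau>"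
  by (rule Stage_inverse)

lemma lin_eq_inner:
  fixes c :: "nat \<Rightarrow> 'i::finite \<Rightarrow> 'v::finite \<Rightarrow> real"
  shows "lin c z = coeffs c \<bullet> z"
proof -
  have range: "Suc 0 \<le> stage_no \<sigma>" "stage_no \<sigma> \<le> CARD('i)" for \<sigma> :: "'i stage"
    using stage_no_range[of \<sigma>] by simp_all
  have st: "(\<Sum>\<tau>=1..CARD('i). f (Stage \<tau> :: 'i stage)) = (\<Sum>\<sigma>\<in>UNIV. f \<sigma>)" for f :: "'i stage \<Rightarrow> real"
    by (rule sum.reindex_bij_witness[where i = stage_no and j = Stage])
      (auto simp: stage_no_inverse stage_no_Stage range)
  have "lin c z = (\<Sum>\<tau>=1..CARD('i). (\<lambda>\<sigma>. \<Sum>i\<in>UNIV. \<Sum>j\<in>UNIV. c (stage_no \<sigma>) i j * z $ (i, j, \<sigma>)) (Stage \<tau>))"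
    unfolding lin_def by (intro sum.cong refl) (simp add: stage_no_Stage)
  also have "\<dots> = (\<Sum>\<sigma>\<in>UNIV. \<Sum>i\<in>UNIV. \<Sum>j\<in>UNIV. c (stage_no \<sigma>) i j * z $ (i, j, \<sigma>))"
    by (rule st)
  also have "\<dots> = (\<Sum>i\<in>UNIV. \<Sum>\<sigma>\<in>UNIV. \<Sum>j\<in>UNIV. c (stage_no \<sigma>) i j * z $ (i, j, \<sigma>))"
    by (rule sum.swap)
  also have "\<dots> = (\<Sum>i\<in>UNIV. \<Sum>j\<in>UNIV. \<Sum>\<sigma>\<in>UNIV. c (stage_no \<sigma>) i j * z $ (i, j, \<sigma>))"
    by (intro sum.cong refl sum.swap)
  also have "\<dots> = (\<Sum>p\<in>UNIV. c (stage_no (snd (snd p))) (fst p) (fst (snd p)) * z $ p)"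
    by (simp add: sum.cartesian_product case_prod_unfold)
  also have "\<dots> = coeffs c \<bullet> z"
    by (simp add: inner_vec_def coeffs_def)
  finally show ?thesis .
qed

definition stage_gain :: "(nat \<Rightarrow> 'i::finite \<Rightarrow> 'v::finite \<Rightarrow> real)
    \<Rightarrow> (nat \<Rightarrow> 'i \<Rightarrow> 'v \<Rightarrow> 'v set \<Rightarrow> real) \<Rightarrow> nat \<Rightarrow> real" where
  "stage_gain c x \<tau> = (\<Sum>S\<in>UNIV. \<Sum>i\<in>UNIV. \<Sum>j\<in>S. c \<tau> i j * x \<tau> i j (S - {j}))"

lemma lin_flow:
  fixes z :: "real ^ ('i::finite \<times> 'v::finite \<times> 'i stage)"
  assumes "flow x y" and z: "\<And>i j \<sigma>. z $ (i, j, \<sigma>) = (\<Sum>S\<in>UNIV. x (stage_no \<sigma>) i j S)"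
  shows "lin c z = (\<Sum>\<tau>=1..CARD('i). stage_gain c x \<tau>)"
  unfolding lin_def
proof (intro sum.cong refl)
  fix \<tau> assume \<tau>: "\<tau> \<in> {1..CARD('i)}"
  have x0: "j \<in> S \<Longrightarrow> x \<tau> i j S = 0" for i j S
    using assms(1) unfolding flow_def by blast
  have "(\<Sum>i\<in>UNIV. \<Sum>j\<in>UNIV. c \<tau> i j * z $ (i, j, Stage \<tau>))
    = (\<Sum>i\<in>UNIV. \<Sum>j\<in>UNIV. \<Sum>S\<in>UNIV. c \<tau> i j * x \<tau> i j S)"
    by (simp add: z stage_no_Stage[OF \<tau>] sum_distrib_left)
  also have "\<dots> = (\<Sum>i\<in>UNIV. \<Sum>S\<in>UNIV. \<Sum>j\<in>S. c \<tau> i j * x \<tau> i j (S - {j}))"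
    by (intro sum.cong refl sum_over_remaining) (simp add: x0)
  also have "\<dots> = stage_gain c x \<tau>"
    unfolding stage_gain_def by (rule sum.swap)
  finally show "(\<Sum>i\<in>UNIV. \<Sum>j\<in>UNIV. c \<tau> i j * z $ (i, j, Stage \<tau>)) = stage_gain c x \<tau>" .
qed

text \<open>One Bellman step on flows: the gain of a stage and the value of the states it produces
  are collected move by move.\<close>

lemma stage_gain_plus_inflow:
  fixes x :: "nat \<Rightarrow> 'i::finite \<Rightarrow> 'v::finite \<Rightarrow> 'v set \<Rightarrow> real"
  assumes "\<tau> < CARD('i)"
  shows "stage_gain c x (Suc \<tau>) + real CARD('i) * (\<Sum>S\<in>UNIV. inflow x y \<tau> S * w S) =
    (\<Sum>S\<in>UNIV. \<Sum>i\<in>UNIV. (\<Sum>j\<in>S. x (Suc \<tau>) i j (S - {j}) * (c (Suc \<tau>) i j + w (S - {j})))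
      + y (Suc \<tau>) i S * w S)"
  unfolding sum_inflow[OF assms] stage_gain_def
  by (simp add: distrib_left sum.distrib mult.commute)

text \<open>Weak duality, by induction from the last stage, with the maxima \<open>m i S\<close> as
  multipliers of the balance constraints. The factor \<open>CARD('i)\<close> undoes the division
  inside \<open>inflow\<close>.\<close>

lemma flow_gain_le:
  fixes x :: "nat \<Rightarrow> 'i::finite \<Rightarrow> 'v::finite \<Rightarrow> 'v set \<Rightarrow> real"
  assumes fl: "flow x y" and "\<tau> \<le> CARD('i)"
  shows "(\<Sum>\<sigma>=1..\<tau>. stage_gain c x \<sigma>) \<le> real CARD('i) * (\<Sum>S\<in>UNIV. inflow x y \<tau> S * optval c \<tau> S)"
  using assms(2)
proof (induction \<tau>)
  case (Suc \<tau>)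
  define m where "m = (\<lambda>i S. Max ((\<lambda>A. gain c (Suc \<tau>) i A + optval c \<tau> (rest S A)) ` moves S))"
  have m: "gain c (Suc \<tau>) i A + optval c \<tau> (rest S A) \<le> m i S" if "A \<in> moves S" for A i S
    unfolding m_def using that by (intro Max_ge) auto
  \<comment> \<open>Balance is only an inequality and is multiplied by \<open>m i S\<close> below,
    so the sign matters; it holds because discarding is always allowed.\<close>
  have m0: "0 \<le> m i S" for i S
    using m[of None S i] optval_nonneg[of c \<tau> S] by (simp add: moves_def)
  have x0: "0 \<le> x (Suc \<tau>) i j S" and y0: "0 \<le> y (Suc \<tau>) i S" for i j S
    using fl unfolding flow_def by blast+
  have bal: "(\<Sum>j\<in>S. x (Suc \<tau>) i j (S - {j})) + y (Suc \<tau>) i S \<le> inflow x y (Suc \<tau>) S" for i S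
  proof -
    have "Suc \<tau> \<in> {1..CARD('i)}" using Suc.prems by simp
    then show ?thesis using fl unfolding flow_def by blast
  qed
  have le: "(\<Sum>j\<in>S. x (Suc \<tau>) i j (S - {j}) * (c (Suc \<tau>) i j + optval c \<tau> (S - {j}))) + y (Suc \<tau>) i S * optval c \<tau> S
      \<le> inflow x y (Suc \<tau>) S * m i S" for i S
  proof -
    have "(\<Sum>j\<in>S. x (Suc \<tau>) i j (S - {j}) * (c (Suc \<tau>) i j + optval c \<tau> (S - {j})))
        \<le> (\<Sum>j\<in>S. x (Suc \<tau>) i j (S - {j}) * m i S)"
      using m[of "Some _" S i] by (intro sum_mono mult_left_mono x0) (auto simp: moves_def)
    moreover have "y (Suc \<tau>) i S * optval c \<tau> S \<le> y (Suc \<tau>) i S * m i S"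
      using m[of None S i] by (intro mult_left_mono y0) (auto simp: moves_def)
    moreover have "((\<Sum>j\<in>S. x (Suc \<tau>) i j (S - {j})) + y (Suc \<tau>) i S) * m i S \<le> inflow x y (Suc \<tau>) S * m i S"
      by (intro mult_right_mono bal m0)
    ultimately show ?thesis by (simp add: distrib_right sum_distrib_right)
  qed
  have "(\<Sum>\<sigma>=1..Suc \<tau>. stage_gain c x \<sigma>)
      \<le> stage_gain c x (Suc \<tau>) + real CARD('i) * (\<Sum>S\<in>UNIV. inflow x y \<tau> S * optval c \<tau> S)"
    using Suc by simp
  also have "\<dots> = (\<Sum>S\<in>UNIV. \<Sum>i\<in>UNIV. (\<Sum>j\<in>S. x (Suc \<tau>) i j (S - {j}) * (c (Suc \<tau>) i j + optval c \<tau> (S - {j})))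
      + y (Suc \<tau>) i S * optval c \<tau> S)"
    using Suc.prems by (intro stage_gain_plus_inflow) simp
  also have "\<dots> \<le> (\<Sum>S\<in>UNIV. \<Sum>i\<in>UNIV. inflow x y (Suc \<tau>) S * m i S)"
    by (intro sum_mono le)
  also have "\<dots> = real CARD('i) * (\<Sum>S\<in>UNIV. inflow x y (Suc \<tau>) S * optval c (Suc \<tau>) S)"
  proof -
    have "(\<Sum>i\<in>UNIV. m i S) = real CARD('i) * optval c (Suc \<tau>) S" for S
      by (simp add: m_def)
    then show ?thesis
      by (subst sum_distrib_left) (simp only: sum_distrib_left[symmetric] mult.left_commute)
  qed
  finally show ?case .
qed simp

lemma sum_inflow_first:
  fixes x :: "nat \<Rightarrow> 'i::finite \<Rightarrow> 'v::finite \<Rightarrow> 'v set \<Rightarrow> real"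
  shows "real CARD('i) * (\<Sum>S\<in>UNIV. inflow x y CARD('i) S * w S) = w UNIV"
proof -
  have "inflow x y CARD('i) S * w S = (if S = UNIV then w UNIV / real CARD('i) else 0)" for S
    by (simp add: inflow_def)
  then show ?thesis by (simp add: sum.delta)
qed

theorem achievable_lin_le:
  fixes z :: "real ^ ('i::finite \<times> 'v::finite \<times> 'i stage)"
  assumes "CARD('v) = CARD('i)" and "z \<in> achievable"
  shows "lin c z \<le> optval c CARD('i) UNIV"
proof -
  obtain x y where *: "flow x y" "\<And>i j \<sigma>. z $ (i, j, \<sigma>) = (\<Sum>S\<in>UNIV. x (stage_no \<sigma>) i j S)"
    using assms unfolding achievable_iff_flow[OF assms(1)] by blast
  show ?thesis
    using lin_flow[OF *, of c] flow_gain_le[OF *(1) order.refl, of c] by (simp add: sum_inflow_first)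
qed

section \<open>Points of policies\<close>

text \<open>Here \<open>d\<close> counts the elapsed stages, whereas \<open>\<tau>\<close> counts down.\<close>

primrec mass :: "(nat \<Rightarrow> 'i::finite \<Rightarrow> 'v::finite set \<Rightarrow> 'v option) \<Rightarrow> nat \<Rightarrow> 'v set \<Rightarrow> real" where
  "mass \<pi> 0 = (\<lambda>S. of_bool (S = UNIV))"
| "mass \<pi> (Suc d) = (\<lambda>S. ((\<Sum>k\<in>UNIV. mass \<pi> d S * of_bool (\<pi> (CARD('i) - d) k S = None))
      + (\<Sum>k\<in>UNIV. \<Sum>j\<in>-S. mass \<pi> d (insert j S) * of_bool (\<pi> (CARD('i) - d) k (insert j S) = Some j)))
      / real CARD('i))"

lemma mass_nonneg: "0 \<le> mass \<pi> d S"
proof (induction d arbitrary: S)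
  case (Suc d)
  then show ?case by (auto intro!: divide_nonneg_nonneg add_nonneg_nonneg sum_nonneg)
qed simp

text \<open>A stage removes at most one ad. This places the variables of a policy in the index
  ranges of the polyhedron.\<close>

lemma mass_support:
  fixes S :: "'v::finite set"
  shows "mass \<pi> d S \<noteq> 0 \<Longrightarrow> CARD('v) \<le> card S + d"
proof (induction d arbitrary: S)
  case (Suc d)
  have "mass \<pi> d S \<noteq> 0 \<or> (\<exists>j\<in>-S. mass \<pi> d (insert j S) \<noteq> 0)"
  proof (rule ccontr)
    assume "\<not> ?thesis"
    then have "mass \<pi> (Suc d) S = 0" by simp
    then show False using Suc.prems by blast
  qed
  then show ?case
  proof
    assume "mass \<pi> d S \<noteq> 0"
    then show ?thesis using Suc.IH[of S] by simp
  next
    assume "\<exists>j\<in>-S. mass \<pi> d (insert j S) \<noteq> 0"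
    then obtain j where "j \<notin> S" "mass \<pi> d (insert j S) \<noteq> 0" by blast
    then show ?thesis using Suc.IH[of "insert j S"] by simp
  qed
qed (auto split: if_splits)

text \<open>The state before the match is \<open>insert j S\<close>. For \<open>\<tau>\<close> above
  \<open>CARD('i)\<close> the truncated difference would return the initial mass and break the
  support condition, hence the guard.\<close>

definition policy_x :: "(nat \<Rightarrow> 'i::finite \<Rightarrow> 'v::finite set \<Rightarrow> 'v option) \<Rightarrow> nat \<Rightarrow> 'i \<Rightarrow> 'v \<Rightarrow> 'v set \<Rightarrow> real" where
  "policy_x \<pi> \<tau> i j S = (if j \<notin> S \<and> \<tau> \<le> CARD('i)
     then mass \<pi> (CARD('i) - \<tau>) (insert j S) / real CARD('i) * of_bool (\<pi> \<tau> i (insert j S) = Some j) else 0)"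

definition policy_y :: "(nat \<Rightarrow> 'i::finite \<Rightarrow> 'v::finite set \<Rightarrow> 'v option) \<Rightarrow> nat \<Rightarrow> 'i \<Rightarrow> 'v set \<Rightarrow> real" where
  "policy_y \<pi> \<tau> i S = (if \<tau> \<le> CARD('i)
     then mass \<pi> (CARD('i) - \<tau>) S / real CARD('i) * of_bool (\<pi> \<tau> i S = None) else 0)"

definition policy_point :: "(nat \<Rightarrow> 'i::finite \<Rightarrow> 'v::finite set \<Rightarrow> 'v option) \<Rightarrow> real ^ ('i \<times> 'v \<times> 'i stage)" where
  "policy_point \<pi> = (\<chi> p. \<Sum>S\<in>UNIV. policy_x \<pi> (stage_no (snd (snd p))) (fst p) (fst (snd p)) S)"

lemma inflow_policy:
  fixes \<pi> :: "nat \<Rightarrow> 'i::finite \<Rightarrow> 'v::finite set \<Rightarrow> 'v option"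
  assumes "\<tau> \<le> CARD('i)"
  shows "inflow (policy_x \<pi>) (policy_y \<pi>) \<tau> S = mass \<pi> (CARD('i) - \<tau>) S / real CARD('i)"
proof (cases "\<tau> = CARD('i)")
  case False
  then obtain d where d: "CARD('i) - \<tau> = Suc d" "CARD('i) - Suc \<tau> = d" "CARD('i) - d = Suc \<tau>"
    using assms by (metis Suc_diff_Suc diff_diff_cancel le_neq_implies_less Suc_leI)
  have "(\<Sum>k\<in>UNIV. policy_y \<pi> (Suc \<tau>) k S) =
      (\<Sum>k\<in>UNIV. mass \<pi> d S * of_bool (\<pi> (Suc \<tau>) k S = None)) / real CARD('i)"
    unfolding sum_divide_distrib using assms False by (intro sum.cong) (simp_all add: policy_y_def d)
  moreover have "(\<Sum>k\<in>UNIV. \<Sum>j\<in>-S. policy_x \<pi> (Suc \<tau>) k j S) =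
      (\<Sum>k\<in>UNIV. \<Sum>j\<in>-S. mass \<pi> d (insert j S) * of_bool (\<pi> (Suc \<tau>) k (insert j S) = Some j)) / real CARD('i)"
    unfolding sum_divide_distrib using assms False by (intro sum.cong refl) (simp add: policy_x_def d)
  ultimately show ?thesis
    using False by (simp add: inflow_def d add_divide_distrib)
qed (simp add: inflow_def)

lemma sum_over_move:
  fixes w :: "'v::finite set \<Rightarrow> real"
  assumes "A \<in> moves S"
  shows "(\<Sum>j\<in>S. m * of_bool (A = Some j) * (f j + w (S - {j}))) + m * of_bool (A = None) * w S
    = m * ((case A of None \<Rightarrow> 0 | Some j \<Rightarrow> f j) + w (rest S A))"
proof (cases A)
  case (Some a)
  then have "a \<in> S" using assms by (auto simp: moves_def)
  have "(\<Sum>j\<in>S. m * of_bool (A = Some j) * (f j + w (S - {j})))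
      = (\<Sum>j\<in>S. if j = a then m * (f a + w (S - {a})) else 0)"
    by (intro sum.cong) (auto simp: Some)
  then show ?thesis using \<open>a \<in> S\<close> Some by (simp add: sum.delta)
qed simp

text \<open>Only the summand of the prescribed move survives. Zero gain and unit weight give the
  balance constraint with equality; a value function as \<open>w\<close> gives the telescoping step
  for \<open>policy_gain\<close>.\<close>

lemma policy_balance:
  fixes \<pi> :: "nat \<Rightarrow> 'i::finite \<Rightarrow> 'v::finite set \<Rightarrow> 'v option"
  assumes "\<tau> \<le> CARD('i)" and "\<pi> \<tau> i S \<in> moves S"
  shows "(\<Sum>j\<in>S. policy_x \<pi> \<tau> i j (S - {j}) * (c \<tau> i j + w (S - {j}))) + policy_y \<pi> \<tau> i S * w S
    = inflow (policy_x \<pi>) (policy_y \<pi>) \<tau> S * (gain c \<tau> i (\<pi> \<tau> i S) + w (rest S (\<pi> \<tau> i S)))"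
proof -
  have "(\<Sum>j\<in>S. policy_x \<pi> \<tau> i j (S - {j}) * (c \<tau> i j + w (S - {j})))
    = (\<Sum>j\<in>S. mass \<pi> (CARD('i) - \<tau>) S / real CARD('i) * of_bool (\<pi> \<tau> i S = Some j) * (c \<tau> i j + w (S - {j})))"
    using assms(1) by (intro sum.cong) (auto simp: policy_x_def insert_absorb)
  then show ?thesis
    using sum_over_move[OF assms(2), of "mass \<pi> (CARD('i) - \<tau>) S / real CARD('i)" "c \<tau> i" w] assms(1)
    by (simp add: inflow_policy policy_y_def gain_def)
qed

lemma flow_policy:
  fixes \<pi> :: "nat \<Rightarrow> 'i::finite \<Rightarrow> 'v::finite set \<Rightarrow> 'v option"
  assumes "CARD('v) = CARD('i)" and mv: "\<And>\<tau> i S. \<pi> \<tau> i S \<in> moves S"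
  shows "flow (policy_x \<pi>) (policy_y \<pi>)"
proof -
  have "j \<notin> S \<and> \<tau> \<le> card S + 1" if "policy_x \<pi> \<tau> i j S \<noteq> 0" for \<tau> i j S
  proof -
    have *: "j \<notin> S" "\<tau> \<le> CARD('i)" "mass \<pi> (CARD('i) - \<tau>) (insert j S) \<noteq> 0"
      using that by (auto simp: policy_x_def split: if_splits)
    then show ?thesis using mass_support[OF *(3)] assms(1) by auto
  qed
  moreover have "\<tau> \<le> card S" if "policy_y \<pi> \<tau> i S \<noteq> 0" for \<tau> i S
  proof -
    have *: "\<tau> \<le> CARD('i)" "mass \<pi> (CARD('i) - \<tau>) S \<noteq> 0"
      using that by (auto simp: policy_y_def split: if_splits)
    then show ?thesis using mass_support[OF *(2)] assms(1) by auto
  qed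
  moreover have "(\<Sum>j\<in>S. policy_x \<pi> \<tau> i j (S - {j})) + policy_y \<pi> \<tau> i S
      = inflow (policy_x \<pi>) (policy_y \<pi>) \<tau> S" if "\<tau> \<in> {1..CARD('i)}" for \<tau> i S
  proof -
    have "gain (\<lambda>_ _ _. 0) \<tau> i A = 0" for A :: "'v option"
      by (cases A) auto
    then show ?thesis
      using policy_balance[of \<tau> \<pi> i S "\<lambda>_ _ _. 0" "\<lambda>_. 1", OF _ mv] that by simp
  qed
  ultimately show ?thesis
    unfolding flow_def by (auto simp: policy_x_def policy_y_def mass_nonneg)
qed

text \<open>The induction of \<open>flow_gain_le\<close>, with equality because a policy uses up its
  inflow and collects exactly the value of its own moves.\<close>

lemma policy_gain:
  fixes \<pi> :: "nat \<Rightarrow> 'i::finite \<Rightarrow> 'v::finite set \<Rightarrow> 'v option"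
  assumes mv: "\<And>\<tau> i S. \<pi> \<tau> i S \<in> moves S" and "\<tau> \<le> CARD('i)"
  shows "(\<Sum>\<sigma>=1..\<tau>. stage_gain c (policy_x \<pi>) \<sigma>)
    = real CARD('i) * (\<Sum>S\<in>UNIV. inflow (policy_x \<pi>) (policy_y \<pi>) \<tau> S * pval \<pi> c \<tau> S)"
  using assms(2)
proof (induction \<tau>)
  case (Suc \<tau>)
  let ?in = "inflow (policy_x \<pi>) (policy_y \<pi>)"
  have "(\<Sum>\<sigma>=1..Suc \<tau>. stage_gain c (policy_x \<pi>) \<sigma>)
      = stage_gain c (policy_x \<pi>) (Suc \<tau>) + real CARD('i) * (\<Sum>S\<in>UNIV. ?in \<tau> S * pval \<pi> c \<tau> S)"
    using Suc by simp
  also have "\<dots> = (\<Sum>S\<in>UNIV. \<Sum>i\<in>UNIV. (\<Sum>j\<in>S. policy_x \<pi> (Suc \<tau>) i j (S - {j}) * (c (Suc \<tau>) i j + pval \<pi> c \<tau> (S - {j})))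
      + policy_y \<pi> (Suc \<tau>) i S * pval \<pi> c \<tau> S)"
    using Suc.prems by (intro stage_gain_plus_inflow) simp
  also have "\<dots> = (\<Sum>S\<in>UNIV. \<Sum>i\<in>UNIV. ?in (Suc \<tau>) S *
      (gain c (Suc \<tau>) i (\<pi> (Suc \<tau>) i S) + pval \<pi> c \<tau> (rest S (\<pi> (Suc \<tau>) i S))))"
    by (intro sum.cong refl policy_balance mv Suc.prems)
  also have "\<dots> = real CARD('i) * (\<Sum>S\<in>UNIV. ?in (Suc \<tau>) S * pval \<pi> c (Suc \<tau>) S)"
  proof -
    have "(\<Sum>i\<in>UNIV. gain c (Suc \<tau>) i (\<pi> (Suc \<tau>) i S) + pval \<pi> c \<tau> (rest S (\<pi> (Suc \<tau>) i S)))
        = real CARD('i) * pval \<pi> c (Suc \<tau>) S" for S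
      by simp
    then show ?thesis
      by (subst sum_distrib_left) (simp only: sum_distrib_left[symmetric] mult.left_commute)
  qed
  finally show ?case .
qed simp

lemma policy_point_achievable:
  fixes \<pi> :: "nat \<Rightarrow> 'i::finite \<Rightarrow> 'v::finite set \<Rightarrow> 'v option"
  assumes "CARD('v) = CARD('i)" and "\<And>\<tau> i S. \<pi> \<tau> i S \<in> moves S"
  shows "policy_point \<pi> \<in> achievable" and "lin c (policy_point \<pi>) = pval \<pi> c CARD('i) UNIV"
proof -
  have z: "policy_point \<pi> $ (i, j, \<sigma>) = (\<Sum>S\<in>UNIV. policy_x \<pi> (stage_no \<sigma>) i j S)" for i j \<sigma>
    by (simp add: policy_point_def)
  note fl = flow_policy[of \<pi>, OF assms]
  show "policy_point \<pi> \<in> achievable"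
    unfolding achievable_iff_flow[OF assms(1)] using fl z by blast
  show "lin c (policy_point \<pi>) = pval \<pi> c CARD('i) UNIV"
    unfolding lin_flow[OF fl z] policy_gain[of \<pi>, OF assms(2) order.refl] by (rule sum_inflow_first)
qed

section \<open>A facet criterion\<close>

text \<open>If the differences of points of \<open>F\<close> spanned less than the hyperplane
  orthogonal to \<open>g\<close>, some nonzero vector of that hyperplane would be orthogonal to all
  of them, hence constant on \<open>F\<close>. Being a multiple of \<open>g\<close> and orthogonal
  to \<open>g\<close>, it would vanish.\<close>

lemma aff_dim_in_hyperplane:
  fixes F :: "'a::euclidean_space set"
  assumes "F \<noteq> {}" and "g \<noteq> 0" and sub: "F \<subseteq> {z. g \<bullet> z = b}"
    and mult: "\<And>a d. (\<And>z. z \<in> F \<Longrightarrow> a \<bullet> z = d) \<Longrightarrow> \<exists>k. a = k *\<^sub>R g"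
  shows "aff_dim F = int DIM('a) - 1"
proof -
  obtain z0 where z0: "z0 \<in> F" using assms(1) by blast
  let ?D = "(\<lambda>z. - z0 + z) ` F"
  let ?T = "{v. g \<bullet> v = 0}"
  have "span ?D \<subseteq> ?T"
    using sub z0 by (intro span_minimal subspace_hyperplane) (auto simp: inner_diff_right subset_iff)
  moreover have "\<not> span ?D \<subset> span ?T"
  proof
    assume "span ?D \<subset> span ?T"
    then obtain a where a: "a \<noteq> 0" "a \<in> span ?T" "\<And>y. y \<in> span ?D \<Longrightarrow> orthogonal a y"
      using orthogonal_to_subspace_exists_gen by blast
    have "a \<bullet> z = a \<bullet> z0" if "z \<in> F" for z
      using a(3)[of "- z0 + z"] that by (simp add: orthogonal_def inner_diff_right span_base)
    then obtain k where "a = k *\<^sub>R g" using mult by blast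
    moreover have "g \<bullet> a = 0"
      using a(2) by (simp add: span_eq_iff[THEN iffD2, OF subspace_hyperplane])
    ultimately have "a \<bullet> a = 0" by simp
    then show False using a(1) by simp
  qed
  ultimately have "span ?D = ?T"
    by (simp add: span_eq_iff[THEN iffD2, OF subspace_hyperplane] psubset_eq)
  then have "dim ?D = DIM('a) - 1"
    using dim_hyperplane[OF assms(2)] by (metis dim_span)
  moreover have "aff_dim F = int (dim ?D)"
    by (rule aff_dim_eq_dim) (simp add: z0 hull_inc)
  ultimately show ?thesis by (simp add: of_nat_diff Suc_le_eq)
qed

text \<open>The points of policies made of best moves lie on the face, so a functional constant on
  the face satisfies the ties of \<open>moves_tie\<close>. What remains for a concrete objective is
  the combinatorial task \<open>mult\<close>: the ties must force proportionality.\<close>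

theorem facet_criterion:
  fixes c :: "nat \<Rightarrow> 'i::finite \<Rightarrow> 'v::finite \<Rightarrow> real"
  assumes card: "CARD('v) = CARD('i)"
    and nz: "\<exists>\<tau>\<in>{1..CARD('i)}. \<exists>i j. c \<tau> i j \<noteq> 0"
    and mult: "\<And>a. (\<And>\<tau> S i A B. reach (best c) (Suc \<tau>) S \<Longrightarrow> A \<in> best c (Suc \<tau>) i S
        \<Longrightarrow> B \<in> best c (Suc \<tau>) i S \<Longrightarrow>
        gain a (Suc \<tau>) i A + opt (best c) a \<tau> (rest S A) = gain a (Suc \<tau>) i B + opt (best c) a \<tau> (rest S B))
      \<Longrightarrow> \<exists>k. \<forall>\<tau>\<in>{1..CARD('i)}. \<forall>i j. a \<tau> i j = k * c \<tau> i j"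
  shows "facet_defining achievable (lin c) (optval c CARD('i) UNIV)"
proof -
  let ?b = "optval c CARD('i) UNIV"
  let ?F = "{z \<in> achievable. lin c z = ?b}"
  have point: "policy_point \<pi> \<in> ?F" if "\<And>\<tau> i S. \<pi> \<tau> i S \<in> best c \<tau> i S" for \<pi>
  proof -
    have mv: "\<pi> \<tau> i S \<in> moves S" for \<tau> i S using that best_subset_moves by blast
    show ?thesis
      using policy_point_achievable[of \<pi>, OF card mv] pval_best[of \<pi>, OF that] by simp
  qed
  have "aff_dim ?F = int DIM(real ^ ('i \<times> 'v \<times> 'i stage)) - 1"
  proof (rule aff_dim_in_hyperplane)
    show "?F \<noteq> {}"
    proof (rule opt_attained[of "best c" c, OF best_nonempty])
      fix \<pi> assume "\<And>\<tau> i S. \<pi> \<tau> i S \<in> best c \<tau> i S"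
      from point[OF this] show "?F \<noteq> {}" by (metis empty_iff)
    qed
    show "coeffs c \<noteq> 0"
    proof
      assume 0: "coeffs c = 0"
      obtain \<tau> i j where "\<tau> \<in> {1..CARD('i)}" "c \<tau> i j \<noteq> 0" using nz by blast
      then have "coeffs c $ (i, j, Stage \<tau>) \<noteq> 0" by (simp add: coeffs_def stage_no_Stage)
      then show False using 0 by simp
    qed
    show "?F \<subseteq> {z. coeffs c \<bullet> z = ?b}" by (auto simp: lin_eq_inner)
    fix v d assume v: "\<And>z. z \<in> ?F \<Longrightarrow> v \<bullet> z = d"
    define a where "a = (\<lambda>\<tau> i j. v $ (i, j, Stage \<tau>))"
    have va: "v = coeffs a"
      by (simp add: vec_eq_iff coeffs_def a_def stage_no_inverse)
    have const: "pval \<pi> a CARD('i) UNIV = d" if \<pi>: "\<And>\<tau> i S. \<pi> \<tau> i S \<in> best c \<tau> i S" for \<pi>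
    proof -
      have mv: "\<pi> \<tau> i S \<in> moves S" for \<tau> i S using \<pi> best_subset_moves by blast
      have "lin a (policy_point \<pi>) = d" using v[OF point[OF \<pi>]] by (simp add: va lin_eq_inner)
      then show ?thesis using policy_point_achievable(2)[of \<pi>, OF card mv] by simp
    qed
    have "\<exists>k. \<forall>\<tau>\<in>{1..CARD('i)}. \<forall>i j. a \<tau> i j = k * c \<tau> i j"
      by (rule mult) (rule moves_tie[OF best_nonempty const])
    then obtain k where k: "\<forall>\<tau>\<in>{1..CARD('i)}. \<forall>i j. a \<tau> i j = k * c \<tau> i j" ..
    have "a (stage_no \<sigma>) i j = k * c (stage_no \<sigma>) i j" for \<sigma> :: "'i stage" and i j
      using k stage_no_range by blast
    then have "v = k *\<^sub>R coeffs c"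
      unfolding va vec_eq_iff by (simp add: coeffs_def)
    then show "\<exists>k. v = k *\<^sub>R coeffs c" by blast
  qed
  then show ?thesis
    unfolding facet_defining_def DIM_points[OF card] using achievable_lin_le[OF card] by blast
qed

section \<open>The staircase objective\<close>

text \<open>
  In stage \<open>t + s\<close> matching an ad of \<open>J\<close> to a type in \<open>Act (t + s)\<close> gains \<open>step s\<close>; by the choice of
  \<open>Act\<close> this has mean \<open>step (s + 1)\<close>.
\<close>

locale staircase =
  fixes J :: "'v::finite set" and t m r :: nat and Act :: "nat \<Rightarrow> 'i::finite set"
  assumes card_eq: "CARD('v) = CARD('i)"
    and t_pos: "1 \<le> t" and m_pos: "1 \<le> m" and m_less: "m < card J"
    and t_le: "t + card J \<le> CARD('i)"
    and r_pos: "1 \<le> r" and r_less: "r < CARD('i)"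
    and Act_early: "\<And>s. s < m \<Longrightarrow> card (Act (t + s)) = 1"
    and Act_middle: "card (Act (t + m)) = r"
    and Act_late: "\<And>s. m < s \<Longrightarrow> Act (t + s) = UNIV"
begin

definition step :: "nat \<Rightarrow> real" where
  "step s = (if s \<le> m then real CARD('i) ^ (m + 1 - s) else real r)"

text \<open>The sum starts at 1 because stage \<open>t + s\<close> has mean gain
  \<open>step (Suc s)\<close>: one ad spent in each of the stages \<open>t\<close> to
  \<open>t + p - 1\<close> earns this much on average.\<close>

definition total :: "nat \<Rightarrow> real" where
  "total p = (\<Sum>l=1..p. step l)"

definition obj :: "nat \<Rightarrow> 'i \<Rightarrow> 'v \<Rightarrow> real" where
  "obj \<tau> i j = (if t \<le> \<tau> \<and> j \<in> J \<and> i \<in> Act \<tau> then step (\<tau> - t) else 0)"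

section \<open>Step sizes and the value function\<close>

lemma step_pos: "0 < step s"
  using r_pos by (simp add: step_def)

lemma step_antimono: "s \<le> s' \<Longrightarrow> step s' \<le> step s"
proof -
  assume "s \<le> s'"
  \<comment> \<open>The powers have come down to n at \<open>s = m\<close>, and \<open>r\<close> is
    below n.\<close>
  have "real r \<le> real CARD('i) ^ (m + 1 - s)" if "s \<le> m"
  proof -
    have "real r \<le> real CARD('i) ^ 1" using r_less by simp
    also have "\<dots> \<le> real CARD('i) ^ (m + 1 - s)"
      using that by (intro power_increasing) (auto simp: Suc_le_eq)
    finally show ?thesis .
  qed
  moreover have "real CARD('i) ^ (m + 1 - s') \<le> real CARD('i) ^ (m + 1 - s)"
    using \<open>s \<le> s'\<close> by (intro power_increasing) (auto simp: Suc_le_eq)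
  ultimately show ?thesis using \<open>s \<le> s'\<close> by (auto simp: step_def)
qed

lemma total_0 [simp]: "total 0 = 0"
  by (simp add: total_def)

lemma total_Suc: "total (Suc p) = total p + step (Suc p)"
  by (simp add: total_def)

lemma total_mono: "p \<le> p' \<Longrightarrow> total p \<le> total p'"
  unfolding total_def by (intro sum_mono2) (auto intro: less_imp_le step_pos)

text \<open>Below \<open>m\<close> one type earns a power of n, at \<open>m\<close> there are
  \<open>r\<close> types earning n, and beyond \<open>m\<close> all types earn \<open>r\<close>;
  each time the mean is the next step.\<close>

lemma card_Act_step: "real (card (Act (t + s))) * step s = real CARD('i) * step (Suc s)"
proof -
  consider "s < m" | "s = m" | "m < s" by linarith
  then show ?thesis
  proof cases
    case 1
    then have "m + 1 - s = Suc (m + 1 - Suc s)" by simp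
    then show ?thesis using 1 by (simp add: Act_early step_def)
  next
    case 2
    then show ?thesis by (simp add: Act_middle step_def)
  next
    case 3
    then show ?thesis by (simp add: Act_late step_def)
  qed
qed

text \<open>The value of the intended move with \<open>k\<close> ads of \<open>J\<close> left: an
  active type takes one if more than \<open>s\<close> are left, and otherwise all are kept.\<close>

definition stage_best :: "nat \<Rightarrow> 'i \<Rightarrow> nat \<Rightarrow> real" where
  "stage_best s i k = (if i \<in> Act (t + s) \<and> s < k then step s + total s else total (min k s))"

lemma card_remove:
  "card ((S - {j}) \<inter> J) = (if j \<in> S \<inter> J then card (S \<inter> J) - 1 else card (S \<inter> J))"
proof -
  have "(S - {j}) \<inter> J = S \<inter> J - {j}" by auto
  then show ?thesis by (simp add: card_Diff_singleton_if)
qed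

text \<open>After stage \<open>t + s\<close> only \<open>s\<close> paying stages remain. If
  \<open>k\<close> is at most \<open>s\<close>, a kept ad is worth \<open>step k\<close>, no less
  than the immediate \<open>step s\<close>; if \<open>k\<close> exceeds \<open>s\<close>, one ad is
  surplus.\<close>

lemma move_value_le:
  assumes "A \<in> moves S"
  shows "gain obj (t + s) i A + total (min (card (rest S A \<inter> J)) s) \<le> stage_best s i (card (S \<inter> J))"
proof -
  let ?k = "card (S \<inter> J)"
  have keep: "total (min ?k s) \<le> stage_best s i ?k"
    using step_pos[of s] by (auto simp: stage_best_def intro!: total_mono add_increasing)
  show ?thesis
  proof (cases A)
    case None
    then show ?thesis using keep by simp
  next
    case (Some j)
    show ?thesis
    proof (cases "j \<in> J")
      case False
      then show ?thesis using keep Some by (simp add: card_remove obj_def)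
    next
      case True
      then have j: "j \<in> S \<inter> J" using assms Some by (auto simp: moves_def)
      then obtain k where k: "?k = Suc k"
        by (metis card_gt_0_iff empty_iff finite gr0_conv_Suc)
      show ?thesis
      proof (cases "i \<in> Act (t + s)")
        case True
        show ?thesis
        proof (cases "Suc k \<le> s")
          case le: True
          have "step s + total k \<le> total (Suc k)"
            using step_antimono[OF le] by (simp add: total_Suc)
          then show ?thesis
            using Some j k True le by (simp add: card_remove obj_def stage_best_def)
        next
          case False
          then have "min k s = s" by simp
          then show ?thesis
            using Some j k True False by (simp add: card_remove obj_def stage_best_def)
        qed
      next
        case False
        then have "gain obj (t + s) i A = 0" using Some by (simp add: obj_def)
        moreover have "total (min (card (rest S A \<inter> J)) s) \<le> total (min ?k s)"
          using Some j by (intro total_mono) (simp add: card_remove)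
        ultimately show ?thesis using keep by simp
      qed
    qed
  qed
qed

lemma stage_best_attained:
  "\<exists>A\<in>moves S. gain obj (t + s) i A + total (min (card (rest S A \<inter> J)) s) = stage_best s i (card (S \<inter> J))"
proof (cases "i \<in> Act (t + s) \<and> s < card (S \<inter> J)")
  case True
  then obtain j where "j \<in> S \<inter> J" by (metis card.empty ex_in_conv not_less_zero)
  moreover have "min (card (S \<inter> J) - 1) s = s" using True by auto
  ultimately show ?thesis using True
    by (intro bexI[of _ "Some j"]) (auto simp: card_remove obj_def stage_best_def moves_def)
next
  case False
  then show ?thesis
    by (intro bexI[of _ None]) (auto simp: stage_best_def moves_def)
qed

lemma Max_stage_best:
  "Max ((\<lambda>A. gain obj (t + s) i A + total (min (card (rest S A \<inter> J)) s)) ` moves S)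
    = stage_best s i (card (S \<inter> J))"
proof (rule Max_eqI)
  show "stage_best s i (card (S \<inter> J)) \<in> (\<lambda>A. gain obj (t + s) i A + total (min (card (rest S A \<inter> J)) s)) ` moves S"
    using stage_best_attained[of S s i] by force
qed (auto intro: move_value_le)

text \<open>Averaged over the types, the bonus \<open>step s\<close> of the active ones becomes
  \<open>step (Suc s)\<close>, the next term of \<open>total\<close>; this closes the induction for
  the value function.\<close>

lemma sum_stage_best:
  "(\<Sum>i\<in>UNIV. stage_best s i k) = real CARD('i) * total (min k (Suc s))"
proof (cases "s < k")
  case True
  have "(\<Sum>i\<in>UNIV. stage_best s i k) = (\<Sum>i\<in>UNIV. of_bool (i \<in> Act (t + s)) * step s + total s)"
    using True by (intro sum.cong) (auto simp: stage_best_def)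
  also have "\<dots> = real (card (Act (t + s))) * step s + real CARD('i) * total s"
    by (simp add: sum.distrib flip: sum_distrib_right)
  finally show ?thesis
    using True by (simp add: card_Act_step total_Suc distrib_left)
qed (simp add: stage_best_def)

lemma gain_obj_early: "\<tau> < t \<Longrightarrow> gain obj \<tau> i A = 0"
  by (cases A) (auto simp: obj_def)

text \<open>The truncated difference \<open>\<tau> + 1 - t\<close> counts the paying stages
  \<open>t\<close> to \<open>\<tau>\<close> and is 0 below \<open>t\<close>.\<close>

lemma optval_obj: "optval obj \<tau> S = total (min (card (S \<inter> J)) (\<tau> + 1 - t))"
proof (induction \<tau> arbitrary: S)
  case 0
  then show ?case using t_pos by simp
next
  case (Suc \<tau>)
  show ?case
  proof (cases "Suc \<tau> < t")
    case True
    have "moves S \<noteq> {}" by (auto simp: moves_def)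
    then show ?thesis using True by (simp add: Suc gain_obj_early image_constant_conv)
  next
    case False
    define s where "s = Suc \<tau> - t"
    have s: "Suc \<tau> = t + s" "\<tau> + 1 - t = s" using False by (auto simp: s_def)
    have "optval obj (Suc \<tau>) S = (\<Sum>i\<in>UNIV. stage_best s i (card (S \<inter> J))) / real CARD('i)"
      by (simp only: opt.simps Suc) (simp only: s Max_stage_best)
    then show ?thesis using s by (simp add: sum_stage_best)
  qed
qed

lemma optval_before:
  "optval obj (t + s - 1) S = total (min (card (S \<inter> J)) s)"
  using t_pos by (simp add: optval_obj)

section \<open>Optimal moves of the staircase objective\<close>

lemma best_early: "\<tau> < t \<Longrightarrow> A \<in> moves S \<Longrightarrow> A \<in> best obj \<tau> i S"
  by (auto simp: best_def gain_obj_early optval_obj)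

lemma bestI:
  assumes "A \<in> moves S"
    and "gain obj (t + s) i A + total (min (card (rest S A \<inter> J)) s) = stage_best s i (card (S \<inter> J))"
  shows "A \<in> best obj (t + s) i S"
  unfolding best_def optval_before using assms move_value_le by auto

lemma best_discard:
  assumes "card (S \<inter> J) \<le> s \<or> i \<notin> Act (t + s)"
  shows "None \<in> best obj (t + s) i S"
  using assms by (intro bestI) (auto simp: moves_def stage_best_def)

lemma best_outside:
  assumes "j \<in> S - J" and "card (S \<inter> J) \<le> s \<or> i \<notin> Act (t + s)"
  shows "Some j \<in> best obj (t + s) i S"
  using assms by (intro bestI) (auto simp: moves_def stage_best_def card_remove obj_def)

text \<open>Spending the ad now gains \<open>step s\<close>, keeping it preserves
  \<open>step (card (S \<inter> J))\<close>; when these agree an active type is indifferent.\<close>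

lemma best_tie:
  assumes "j \<in> S \<inter> J" and "card (S \<inter> J) \<le> s" and "step (card (S \<inter> J)) = step s"
  assumes "i \<in> Act (t + s)"
  shows "Some j \<in> best obj (t + s) i S"
proof -
  obtain k where k: "card (S \<inter> J) = Suc k"
    using assms(1) by (metis card_gt_0_iff empty_iff finite gr0_conv_Suc)
  have "step s + total k = total (Suc k)" using assms(3) k by (simp add: total_Suc)
  then show ?thesis
    using assms k by (intro bestI) (auto simp: moves_def stage_best_def card_remove obj_def min_def)
qed

text \<open>A surplus ad is worthless later, so using it is optimal even for an inactive
  type.\<close>

lemma best_match:
  assumes "j \<in> S \<inter> J" and "s < card (S \<inter> J)"
  shows "Some j \<in> best obj (t + s) i S"
proof -
  have "min (card (S \<inter> J) - 1) s = s" using assms(2) by simp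
  then show ?thesis
    using assms by (intro bestI) (auto simp: moves_def stage_best_def card_remove obj_def)
qed

section \<open>States reachable by optimal moves\<close>

lemma inactive_ex: "s \<le> m \<Longrightarrow> \<exists>i. i \<notin> Act (t + s)"
proof (rule ccontr)
  assume "s \<le> m" "\<nexists>i. i \<notin> Act (t + s)"
  then have "Act (t + s) = UNIV" by auto
  then show False
    using Act_early[of s] Act_middle r_less r_pos \<open>s \<le> m\<close> by (cases "s = m") auto
qed

lemma active_ex: "\<exists>i. i \<in> Act (t + s)"
proof -
  consider "s < m" | "s = m" | "m < s" by linarith
  then have "Act (t + s) \<noteq> {}"
    using Act_early[of s] Act_middle Act_late[of s] r_pos by cases auto
  then show ?thesis by blast
qed

lemma Int_Un_Compl: "K \<subseteq> J \<Longrightarrow> (K \<union> - J) \<inter> J = K"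
  by auto

text \<open>Induction towards the first stage: the predecessor has the same \<open>K\<close>, left
  by a discard, or one more ad of \<open>J\<close>, spent in a tie. The last assumption says that at
  most one ad is spent per elapsed stage; the two bounds on \<open>card K\<close> keep the chosen
  moves optimal.\<close>

lemma reach_best:
  assumes "\<tau> \<le> CARD('i)" and "K \<subseteq> J"
    and "min (\<tau> - t) m \<le> card K" and "card K \<le> max (\<tau> - t) m + 1"
    and "card J + \<tau> \<le> card K + CARD('i)"
  shows "reach (best obj) \<tau> (K \<union> - J)"
  using assms
proof (induction arbitrary: K rule: inc_induct)
  case base
  then have "K = J" by (intro card_seteq) auto
  then show ?case using reach.start[of "best obj"] by simp
next
  case (step \<tau>)
  let ?S = "K \<union> - J"
  note K = Int_Un_Compl[OF step.prems(1)]
  have discard: ?case if "reach (best obj) (Suc \<tau>) ?S" "None \<in> best obj (Suc \<tau>) i ?S" for i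
    using reach.step[OF that] by simp
  have match: ?case if "j \<in> J - K" "reach (best obj) (Suc \<tau>) (insert j K \<union> - J)"
      "Some j \<in> best obj (Suc \<tau>) i (insert j K \<union> - J)" for i j
  proof -
    have "rest (insert j K \<union> - J) (Some j) = ?S" using that(1) by auto
    then show ?thesis using reach.step[OF that(2,3)] by simp
  qed
  show ?case
  proof (cases "Suc \<tau> < t")
    case True
    show ?thesis
    proof (rule discard)
      show "reach (best obj) (Suc \<tau>) ?S"
        using True step.prems t_le by (intro step.IH) auto
      show "None \<in> best obj (Suc \<tau>) undefined ?S"
        using True by (intro best_early) (auto simp: moves_def)
    qed
  next
    case False
    then obtain s where s: "Suc \<tau> = t + s" by (metis le_iff_add not_less)
    have st: "\<tau> - t = s - 1" using s by simp
    have more: ?thesis if less: "card K < s" "step (Suc (card K)) = step s" "card K < card J"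
      and "min s m \<le> Suc (card K)" "card J + (t + s) \<le> Suc (card K) + CARD('i)"
    proof -
      have "\<not> J \<subseteq> K" using less(3) card_mono[of K J] by auto
      then obtain j where j: "j \<in> J - K" by blast
      have cj: "card (insert j K) = Suc (card K)" using j by simp
      have Kj: "insert j K \<subseteq> J" using j step.prems(1) by blast
      obtain i where i: "i \<in> Act (t + s)" using active_ex by blast
      show ?thesis
      proof (rule match[OF j])
        show "reach (best obj) (Suc \<tau>) (insert j K \<union> - J)"
          using that s by (intro step.IH Kj) (auto simp: cj)
        show "Some j \<in> best obj (Suc \<tau>) i (insert j K \<union> - J)"
          unfolding s using less j i by (intro best_tie) (auto simp only: Int_Un_Compl[OF Kj] cj)
      qed
    qed
    show ?thesis
    proof (cases "min s m \<le> card K \<and> card J + (t + s) \<le> card K + CARD('i)")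
      case True
      \<comment> \<open>By the upper bound, more than \<open>s\<close> ads of \<open>J\<close> occur
        only for \<open>s \<le> m\<close>, and then some inactive type may discard.\<close>
      have "\<exists>i. card K \<le> s \<or> i \<notin> Act (t + s)"
        using inactive_ex[of s] step.prems(3) st by (cases "card K \<le> s") auto
      then obtain i where i: "card K \<le> s \<or> i \<notin> Act (t + s)" by blast
      show ?thesis
      proof (rule discard)
        show "reach (best obj) (Suc \<tau>) ?S"
          using True s st step.prems by (intro step.IH) auto
        show "None \<in> best obj (Suc \<tau>) i ?S"
          unfolding s using i by (intro best_discard) (simp add: K)
      qed
    next
      case F: False
      show ?thesis
      proof (cases "card K < min s m")
        case True
        \<comment> \<open>The lower bound has just risen by one, so the predecessor has exactly
          \<open>s\<close> ads of \<open>J\<close> and the tie compares \<open>step s\<close> with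
          itself.\<close>
        then have "Suc (card K) = s" using step.prems(2) st by auto
        then show ?thesis using True m_less t_le by (intro more) auto
      next
        case False
        \<comment> \<open>The budget of one ad per stage is exhausted. This forces
          \<open>Suc (card K)\<close> and \<open>s\<close> both beyond \<open>m\<close>, where every
          step equals \<open>r\<close>.\<close>
        then have eq: "card J + (t + s) = Suc (card K) + CARD('i)"
          using F step.prems(4) s by auto
        then have Ks: "card K < s" "card K < card J" using t_le step.hyps s by auto
        then have "m \<le> card K" using False by auto
        then show ?thesis using Ks eq by (intro more) (auto simp: step_def)
      qed
    qed
  qed
qed

section \<open>Determining the coefficients from ties\<close>

lemma subset_containing:
  assumes "j \<in> J" "1 \<le> p" "p \<le> card J"
  obtains K where "K \<subseteq> J" "j \<in> K" "card K = p"
proof -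
  have "p - 1 \<le> card (J - {j})" using assms by simp
  then obtain K where K: "K \<subseteq> J - {j}" "card K = p - 1" by (metis obtain_subset_with_card_n)
  then have "card (insert j K) = p" using assms(2) by (subst card_insert_disjoint) auto
  then show ?thesis using K assms(1) that[of "insert j K"] by blast
qed

text \<open>Strong induction on the stage number, so from the last stage backwards: once the later
  coefficients are known, a single tie in a suitable reachable state determines each further
  one.\<close>

lemma coefficients_proportional:
  assumes tie: "\<And>\<tau> S i A B. reach (best obj) (Suc \<tau>) S \<Longrightarrow> A \<in> best obj (Suc \<tau>) i S
      \<Longrightarrow> B \<in> best obj (Suc \<tau>) i S \<Longrightarrow>
      gain a (Suc \<tau>) i A + opt (best obj) a \<tau> (rest S A) = gain a (Suc \<tau>) i B + opt (best obj) a \<tau> (rest S B)"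
  shows "\<exists>k. \<forall>\<tau>\<in>{1..CARD('i)}. \<forall>i j. a \<tau> i j = k * obj \<tau> i j"
proof -
  obtain i0 where i0: "Act t = {i0}" using Act_early[of 0] m_pos by (auto simp: card_1_singleton_iff)
  obtain j0 where j0: "j0 \<in> J" using m_less by (metis card.empty ex_in_conv not_less_zero)
  \<comment> \<open>The one free parameter, read off at the only active type of stage
    \<open>t\<close>.\<close>
  define \<kappa> where "\<kappa> = a t i0 j0 / step 0"
  have "a \<tau> i j = \<kappa> * obj \<tau> i j" if "\<tau> \<in> {1..CARD('i)}" for \<tau> i j
    using that
  proof (induction \<tau> arbitrary: i j rule: less_induct)
    case (less \<tau>)
    then obtain \<tau>' where \<tau>': "\<tau> = Suc \<tau>'" by (metis atLeastAtMost_iff not_less_eq_eq old.nat.exhaust One_nat_def le_zero_eq)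
    \<comment> \<open>The induction hypothesis covers all later stages, so \<open>opt_scale\<close>
      gives the continuation values of \<open>a\<close>.\<close>
    have W: "opt (best obj) a \<tau>' S = \<kappa> * optval obj \<tau>' S" for S
      using less \<tau>' by (intro opt_scale) auto
    have exch: "gain a \<tau> i A + \<kappa> * optval obj \<tau>' (rest S A) = gain a \<tau> i B + \<kappa> * optval obj \<tau>' (rest S B)"
      if "reach (best obj) \<tau> S" "A \<in> best obj \<tau> i S" "B \<in> best obj \<tau> i S" for S A B
      using tie[of \<tau>' S A i B] that by (simp add: \<tau>' W)
    show ?case
    proof (cases "\<tau> < t")
      case True
      obtain K where K: "K \<subseteq> J" "card K = 1" "j \<in> K \<union> - J"
        using j0 by (cases "j \<in> J") (auto intro: that[of "{j}"] that[of "{j0}"])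
      have "reach (best obj) \<tau> (K \<union> - J)"
        using K True less.prems t_le by (intro reach_best) auto
      moreover have "Some j \<in> best obj \<tau> i (K \<union> - J)" "None \<in> best obj \<tau> i (K \<union> - J)"
        using K(3) True by (auto intro!: best_early simp: moves_def)
      ultimately have "gain a \<tau> i (Some j) + \<kappa> * optval obj \<tau>' (rest (K \<union> - J) (Some j))
          = gain a \<tau> i None + \<kappa> * optval obj \<tau>' (rest (K \<union> - J) None)"
        by (rule exch)
      then show ?thesis using True \<tau>' by (simp add: optval_obj obj_def)
    next
      case False
      then obtain s where s: "\<tau> = t + s" by (metis le_iff_add not_less)
      have opt': "optval obj \<tau>' S = total (min (card (S \<inter> J)) s)" for S
      proof -
        have "\<tau>' = t + s - 1" using s \<tau>' by simp
        then show ?thesis by (simp only: optval_before)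
      qed
      have range: "t + s \<le> CARD('i)" using less.prems s by simp
      show ?thesis
      proof (cases "j \<in> J")
        case jJ: False
        \<comment> \<open>With at most \<open>s\<close> ads of \<open>J\<close> left, every type,
          active or not, may discard or use an outside ad.\<close>
        obtain K where K: "K \<subseteq> J" "card K = min s (card J)"
          by (metis min.cobounded2 obtain_subset_with_card_n)
        have "reach (best obj) \<tau> (K \<union> - J)"
          using K less.prems range m_less t_le s by (intro reach_best) auto
        moreover have "Some j \<in> best obj \<tau> i (K \<union> - J)" "None \<in> best obj \<tau> i (K \<union> - J)"
          unfolding s using K jJ by (auto intro!: best_outside best_discard simp: Int_Un_Compl)
        ultimately have "gain a \<tau> i (Some j) + \<kappa> * optval obj \<tau>' (rest (K \<union> - J) (Some j))
            = gain a \<tau> i None + \<kappa> * optval obj \<tau>' (rest (K \<union> - J) None)"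
          by (rule exch)
        then show ?thesis using jJ by (simp add: opt' card_remove obj_def)
      next
        case jJ: True
        show ?thesis
        proof (cases "i \<in> Act \<tau>")
          case False
          then have sm: "s \<le> m" using Act_late[of s] s by (metis UNIV_I not_le)
          \<comment> \<open>Exactly one ad is surplus, so an inactive type is indifferent between
            wasting \<open>j\<close> and discarding.\<close>
          obtain K where K: "K \<subseteq> J" "j \<in> K" "card K = s + 1"
            using subset_containing[OF jJ, of "s + 1"] sm m_less by auto
          have "reach (best obj) \<tau> (K \<union> - J)"
            using K less.prems sm s t_le by (intro reach_best) auto
          moreover have "Some j \<in> best obj \<tau> i (K \<union> - J)"
            unfolding s using K jJ by (intro best_match) (simp_all add: Int_Un_Compl)
          moreover have "None \<in> best obj \<tau> i (K \<union> - J)"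
            unfolding s using False s by (intro best_discard) simp
          ultimately have "gain a \<tau> i (Some j) + \<kappa> * optval obj \<tau>' (rest (K \<union> - J) (Some j))
              = gain a \<tau> i None + \<kappa> * optval obj \<tau>' (rest (K \<union> - J) None)"
            by (rule exch)
          then show ?thesis
            using False jJ K by (simp add: opt' card_remove obj_def Int_Un_Compl)
        next
          case act: True
          show ?thesis
          proof (cases "s = 0")
            case True
            \<comment> \<open>In stage \<open>t\<close> an active type strictly prefers matching, so
              only two ads can be compared with each other; they may coincide.\<close>
            let ?K = "{j, j0}"
            have sub: "?K \<subseteq> J" using jJ j0 by simp
            have card: "1 \<le> card ?K" "card ?K \<le> 2" by (auto simp: card_insert_if)
            have "reach (best obj) \<tau> (?K \<union> - J)"
              using True sub card m_pos s t_le by (intro reach_best) auto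
            moreover have "Some j \<in> best obj \<tau> i (?K \<union> - J)" "Some j0 \<in> best obj \<tau> i (?K \<union> - J)"
              unfolding s using True card jJ j0
              by (auto intro!: best_match simp only: Int_Un_Compl[OF sub])
            ultimately have "gain a \<tau> i (Some j) + \<kappa> * optval obj \<tau>' (rest (?K \<union> - J) (Some j))
                = gain a \<tau> i (Some j0) + \<kappa> * optval obj \<tau>' (rest (?K \<union> - J) (Some j0))"
              by (rule exch)
            then have "a t i j = a t i j0" using True s by (simp add: opt')
            then show ?thesis
              using act jJ i0 True s step_pos[of 0] by (simp add: obj_def \<kappa>_def)
          next
            case False
            \<comment> \<open>This size makes an active type indifferent: either
              \<open>card K = s\<close>, or \<open>card K\<close> and \<open>s\<close> both exceed
              \<open>m\<close> and both steps equal \<open>r\<close>.\<close>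
            obtain K where K: "K \<subseteq> J" "j \<in> K" "card K = min s (card J)"
              using subset_containing[OF jJ, of "min s (card J)"] False m_less by auto
            have "card K \<noteq> 0" using K(3) False m_less by simp
            then obtain k where k: "card K = Suc k" by (metis not0_implies_Suc)
            have stp: "step (card K) = step s"
              unfolding K(3) using m_less by (auto simp: step_def min_def)
            have ks: "card K \<le> s" using K(3) by simp
            have "reach (best obj) \<tau> (K \<union> - J)"
              using K less.prems range m_less t_le s by (intro reach_best) auto
            moreover have "Some j \<in> best obj \<tau> i (K \<union> - J)"
              unfolding s using K(2) jJ act s ks stp by (intro best_tie) (simp_all add: Int_Un_Compl[OF K(1)])
            moreover have "None \<in> best obj \<tau> i (K \<union> - J)"
              unfolding s using ks by (intro best_discard) (simp add: Int_Un_Compl[OF K(1)])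
            ultimately have "gain a \<tau> i (Some j) + \<kappa> * optval obj \<tau>' (rest (K \<union> - J) (Some j))
                = gain a \<tau> i None + \<kappa> * optval obj \<tau>' (rest (K \<union> - J) None)"
              by (rule exch)
            then have "a \<tau> i j + \<kappa> * total k = \<kappa> * total (Suc k)"
              using jJ K(2) k ks
              by (simp add: opt' card_remove Int_Un_Compl[OF K(1)] min_def)
            then show ?thesis
              using act jJ s stp k by (simp add: obj_def total_Suc distrib_left)
          qed
        qed
      qed
    qed
  qed
  then show ?thesis by blast
qed

theorem facet_staircase: "facet_defining achievable (lin obj) (total (card J))"
proof -
  obtain i where "i \<in> Act (t + 0)" using active_ex by blast
  moreover obtain j where "j \<in> J" using m_less by (metis card.empty ex_in_conv not_less_zero)
  ultimately have "obj t i j \<noteq> 0" using step_pos[of 0] by (simp add: obj_def)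
  then have "\<exists>\<tau>\<in>{1..CARD('i)}. \<exists>i j. obj \<tau> i j \<noteq> 0"
    using t_pos t_le by (intro bexI[of _ t]) auto
  then have "facet_defining achievable (lin obj) (optval obj CARD('i) UNIV)"
    by (intro facet_criterion[OF card_eq] coefficients_proportional)
  moreover have "min (card J) (CARD('i) + 1 - t) = card J" using t_le by simp
  ultimately show ?thesis by (simp add: optval_obj)
qed

section \<open>Translation into the stated inequality\<close>

lemma lin_obj:
  "lin obj z = (\<Sum>\<tau>=t..t+m-1. real CARD('i) ^ (t + m + 1 - \<tau>) * Zsum z (Act \<tau>) J \<tau>)
    + real CARD('i) * Zsum z (Act (t + m)) J (t + m)
    + real r * (\<Sum>\<tau>=t+m+1..CARD('i). Zsum z UNIV J \<tau>)"
proof -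
  let ?w = "\<lambda>\<tau>. step (\<tau> - t) * Zsum z (Act \<tau>) J \<tau>"
  have inner: "(\<Sum>i\<in>UNIV. \<Sum>j\<in>UNIV. obj \<tau> i j * z $ (i, j, Stage \<tau>)) = (if t \<le> \<tau> then ?w \<tau> else 0)" for \<tau>
  proof (cases "t \<le> \<tau>")
    case True
    have "(\<Sum>i\<in>UNIV. \<Sum>j\<in>UNIV. obj \<tau> i j * z $ (i, j, Stage \<tau>))
        = (\<Sum>i\<in>Act \<tau>. \<Sum>j\<in>UNIV. obj \<tau> i j * z $ (i, j, Stage \<tau>))"
      by (rule sum.mono_neutral_right) (auto simp: obj_def)
    also have "\<dots> = (\<Sum>i\<in>Act \<tau>. \<Sum>j\<in>J. obj \<tau> i j * z $ (i, j, Stage \<tau>))"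
      by (intro sum.cong sum.mono_neutral_right refl) (auto simp: obj_def)
    also have "\<dots> = ?w \<tau>"
      unfolding Zsum_def sum_distrib_left using True by (intro sum.cong) (auto simp: obj_def)
    finally show ?thesis using True by simp
  qed (simp add: obj_def)
  have "lin obj z = (\<Sum>\<tau>=1..CARD('i). if t \<le> \<tau> then ?w \<tau> else 0)"
    unfolding lin_def inner ..
  also have "\<dots> = (\<Sum>\<tau>=t..CARD('i). ?w \<tau>)"
    using t_pos by (intro sum.mono_neutral_cong_right) auto
  also have "{t..CARD('i)} = {t..t+m-1} \<union> ({t+m} \<union> {t+m+1..CARD('i)})"
    using t_le m_less m_pos t_pos by auto
  also have "(\<Sum>\<tau>\<in>\<dots>. ?w \<tau>) = (\<Sum>\<tau>=t..t+m-1. ?w \<tau>) + (?w (t + m) + (\<Sum>\<tau>=t+m+1..CARD('i). ?w \<tau>))"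
    using t_pos m_pos by (subst sum.union_disjoint; (subst sum.union_disjoint)?) auto
  also have "(\<Sum>\<tau>=t..t+m-1. ?w \<tau>) = (\<Sum>\<tau>=t..t+m-1. real CARD('i) ^ (t + m + 1 - \<tau>) * Zsum z (Act \<tau>) J \<tau>)"
  proof (rule sum.cong)
    fix \<tau> assume "\<tau> \<in> {t..t+m-1}"
    then have "\<tau> - t \<le> m" "m + 1 - (\<tau> - t) = t + m + 1 - \<tau>" by auto
    then show "?w \<tau> = real CARD('i) ^ (t + m + 1 - \<tau>) * Zsum z (Act \<tau>) J \<tau>"
      by (simp only: step_def if_True)
  qed simp
  also have "?w (t + m) = real CARD('i) * Zsum z (Act (t + m)) J (t + m)"
    by (simp add: step_def)
  also have "(\<Sum>\<tau>=t+m+1..CARD('i). ?w \<tau>) = real r * (\<Sum>\<tau>=t+m+1..CARD('i). Zsum z UNIV J \<tau>)"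
    unfolding sum_distrib_left
  proof (rule sum.cong)
    fix \<tau> assume "\<tau> \<in> {t+m+1..CARD('i)}"
    then have "m < \<tau> - t" "\<tau> = t + (\<tau> - t)" by auto
    then show "?w \<tau> = real r * Zsum z UNIV J \<tau>"
      using Act_late[of "\<tau> - t"] by (simp add: step_def)
  qed simp
  finally show ?thesis by simp
qed

lemma total_card: "total (m + p) = real r * real p + (\<Sum>l=1..m. real CARD('i) ^ (m + 1 - l))"
proof (induction p)
  case 0
  then show ?case by (auto simp: total_def step_def intro!: sum.cong)
next
  case (Suc p)
  then show ?case by (simp add: total_Suc step_def distrib_left)
qed

end

theorem theorem7:
  fixes n h r t q :: nat
    and J :: "'v::finite set" and I :: "'i::finite set" and im :: "nat \<Rightarrow> 'i"
  assumes "n \<ge> 1" and "CARD('i) = n" and "CARD('v) = n"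
    and "h \<in> {2..n-1}" and "r \<in> {1..n-1}" and "t \<in> {1..n-h}" and "q \<in> {0..h-2}"
    and "card J = h" and "card I = r"
  shows "facet_defining (achievable :: (real ^ ('i \<times> 'v \<times> 'i stage)) set)
    (\<lambda>z. real r * (\<Sum>\<tau>=t+h-q..n. Zsum z UNIV J \<tau>)
       + real n * Zsum z I J (t+h-q-1)
       + (\<Sum>\<tau>=t..t+h-q-2. real n ^ (t+h-q-\<tau>) * Zsum z {im \<tau>} J \<tau>))
    (real r * real (q + 1) + (\<Sum>\<tau>=1..h-q-1. real n ^ (h-q-\<tau>)))"
proof -
  \<comment> \<open>The number of stages with a single prescribed type; the set \<open>I\<close>
    belongs to stage \<open>t + m\<close>. The remaining \<open>q + 1\<close> of the
    \<open>h\<close> ads contribute \<open>r\<close> each to the right-hand side.\<close>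
  define m where "m = h - q - 1"
  define Act where "Act = (\<lambda>\<tau>. if \<tau> < t + m then {im \<tau>} else if \<tau> = t + m then I else UNIV)"
  have idx: "t + h - q = t + m + 1" "t + h - q - 1 = t + m" "t + h - q - 2 = t + m - 1"
      "h - q = m + 1" "h - q - 1 = m" "h = m + (q + 1)"
    using assms by (auto simp: m_def)
  interpret staircase J t m r Act
    using assms by unfold_locales (auto simp: Act_def m_def)
  have "lin obj = (\<lambda>z. real r * (\<Sum>\<tau>=t+h-q..n. Zsum z UNIV J \<tau>)
       + real n * Zsum z I J (t+h-q-1)
       + (\<Sum>\<tau>=t..t+h-q-2. real n ^ (t+h-q-\<tau>) * Zsum z {im \<tau>} J \<tau>))"
  proof (rule ext)
    fix z :: "real ^ ('i \<times> 'v \<times> 'i stage)"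
    have "(\<Sum>\<tau>=t..t+m-1. real n ^ (t+m+1-\<tau>) * Zsum z (Act \<tau>) J \<tau>)
        = (\<Sum>\<tau>=t..t+m-1. real n ^ (t+m+1-\<tau>) * Zsum z {im \<tau>} J \<tau>)"
      using m_pos by (intro sum.cong) (auto simp: Act_def)
    moreover have "Act (t + m) = I" by (simp add: Act_def)
    ultimately show "lin obj z = real r * (\<Sum>\<tau>=t+h-q..n. Zsum z UNIV J \<tau>)
       + real n * Zsum z I J (t+h-q-1)
       + (\<Sum>\<tau>=t..t+h-q-2. real n ^ (t+h-q-\<tau>) * Zsum z {im \<tau>} J \<tau>)"
      unfolding lin_obj idx assms(2) by simp
  qed
  moreover have "total (card J) = real r * real (q + 1) + (\<Sum>\<tau>=1..h-q-1. real n ^ (h-q-\<tau>))"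
    using total_card[of "q + 1"] idx(4-6) assms(2,8) by simp
  ultimately show ?thesis
    using facet_staircase by (simp only:)
qed

end
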